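(* Let $\lambda=(p,q,r;a,b;x)$ satisfy $p,q,r,a,b\in\mathbb{R}$, $0<p<r$, $0<q<r$, $-1<x<1$, $x\neq0$. If $\lambda$ is a non-elementary solution of type (A) to the closed-form problem, then $\lambda$ comes from contiguous relations.
   Context: For $\lambda=(p,q,r;a,b;x)$ put $f(w)={}_2F_1(pw+a,\,qw+b;\,rw;\,x)$ (Gauss hypergeometric series), a meromorphic function of $w\in\mathbb{C}$. $\lambda$ is a solution to the closed-form problem if $R(w):=f(w+1)/f(w)\in\mathbb{C}(w)$; it is elementary if $f$ has at most finitely many poles in $\mathbb{C}$, and non-elementary otherwise. A canonical form of $R(w)$ is a representation $R(w)=\frac{S(w+1)}{S(w)}\cdot d\cdot\frac{(w+u_1)\cdots(w+u_m)}{(w+v_1)\cdots(w+v_n)}$ with $S(w)$ a rational function, $d\neq0$, $u_i-v_j\notin\mathbb{Z}$ for all $i,j$, and $S$, $d$, $\prod_i(w+u_i)$, $\prod_j(w+v_j)$ real when $R$ is real. A non-elementary solution is of type (A) if $r$ is a positive integer, $p,q\in\mathbb{Z}$, $p+q+r$ is even, and $pu_i-a,\ qu_i-b\in\mathbb{R}\setminus\mathbb{Z}$ for $i=1,\dots,m$. For integers $p,q,r$, composing Gauss's contiguous relations gives $${}_2F_1(\alpha+p,\beta+q;\gamma+r;z)=R_{p,q,r}(\alpha,\beta;\gamma;z)\,{}_2F_1(\alpha,\beta;\gamma;z)+Q_{p,q,r}(\alpha,\beta;\gamma;z)\,{}_2F_1(\alpha+1,\beta+1;\gamma+1;z),$$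 where $R_{p,q,r}$ and $Q_{p,q,r}$ are rational functions of $(\alpha,\beta;\gamma;z)$ depending uniquely on $(p,q,r)$. Put $Q(w):=Q_{p,q,r}(pw+a,qw+b;rw;x)$. A solution $\lambda$ with $p,q,r\in\mathbb{Z}$ is said to come from contiguous relations if $Q(w)$ vanishes identically in $\mathbb{C}(w)$ (so that the three-term relation specialised at $(\alpha,\beta;\gamma;z)=(pw+a,qw+b;rw;x)$ reduces to $f(w+1)=R(w)f(w)$). *)

theory Defs
  imports
    "HOL-Complex_Analysis.Complex_Analysis"
    "HOL-Computational_Algebra.Computational_Algebra"
begin

section \<open>The Gauss hypergeometric series\<close>

definition Gauss_2F1 :: "complex \<Rightarrow> complex \<Rightarrow> complex \<Rightarrow> complex \<Rightarrow> complex" where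
  "Gauss_2F1 \<alpha> \<beta> \<gamma> z = eval_fps (fps_hypergeo [\<alpha>, \<beta>] [\<gamma>] 1) z"

lemma Gauss_2F1_altdef:
  "Gauss_2F1 \<alpha> \<beta> \<gamma> z =
     (\<Sum>n. pochhammer \<alpha> n * pochhammer \<beta> n / (pochhammer \<gamma> n * fact n) * z ^ n)"
  by (simp add: Gauss_2F1_def eval_fps_def)

section \<open>Rational functions of one complex variable\<close>

text \<open>
  Rational and meromorphic functions are represented by functions on the complex numbers whose
  values on a discrete closed set are irrelevant: identities between them are stated with the
  filter \<^term>\<open>cosparse UNIV\<close>. This takes care of \<open>x / 0 = 0\<close> at zeros of denominators.
\<close>

definition rational_fun :: "(complex \<Rightarrow> complex) \<Rightarrow> bool" where
  "rational_fun g \<longleftrightarrow>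
     (\<exists>P Q :: complex poly. Q \<noteq> 0 \<and> (\<forall>\<^sub>\<approx>w. g w = poly P w / poly Q w))"

text \<open>A rational function is real if it belongs to the field of rational functions over the reals.\<close>

definition real_rational_fun :: "(complex \<Rightarrow> complex) \<Rightarrow> bool" where
  "real_rational_fun g \<longleftrightarrow>
     (\<exists>P Q :: real poly. Q \<noteq> 0 \<and>
        (\<forall>\<^sub>\<approx>w. g w = poly (map_poly of_real P) w / poly (map_poly of_real Q) w))"

section \<open>The closed-form problem\<close>

text \<open>
  At the points \<open>w\<close> with \<open>r w\<close> a nonpositive integer the value of the following function is
  meaningless; they are isolated if \<open>r \<noteq> 0\<close>. For \<open>\<bar>x\<bar> < 1\<close> the function is
  holomorphic elsewhere, so it represents a meromorphic function.
\<close>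

definition hyp_f ::
  "complex \<Rightarrow> complex \<Rightarrow> complex \<Rightarrow> complex \<Rightarrow> complex \<Rightarrow> complex \<Rightarrow> complex \<Rightarrow> complex" where
  "hyp_f p q r a b x w = Gauss_2F1 (p * w + a) (q * w + b) (r * w) x"

definition hyp_ratio ::
  "complex \<Rightarrow> complex \<Rightarrow> complex \<Rightarrow> complex \<Rightarrow> complex \<Rightarrow> complex \<Rightarrow> complex \<Rightarrow> complex" where
  "hyp_ratio p q r a b x w = hyp_f p q r a b x (w + 1) / hyp_f p q r a b x w"

definition closed_form_solution ::
  "complex \<Rightarrow> complex \<Rightarrow> complex \<Rightarrow> complex \<Rightarrow> complex \<Rightarrow> complex \<Rightarrow> bool" where
  "closed_form_solution p q r a b x \<longleftrightarrow> rational_fun (hyp_ratio p q r a b x)"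

definition elementary ::
  "complex \<Rightarrow> complex \<Rightarrow> complex \<Rightarrow> complex \<Rightarrow> complex \<Rightarrow> complex \<Rightarrow> bool" where
  "elementary p q r a b x \<longleftrightarrow>
     closed_form_solution p q r a b x \<and> finite {w. is_pole (hyp_f p q r a b x) w}"

definition non_elementary ::
  "complex \<Rightarrow> complex \<Rightarrow> complex \<Rightarrow> complex \<Rightarrow> complex \<Rightarrow> complex \<Rightarrow> bool" where
  "non_elementary p q r a b x \<longleftrightarrow>
     closed_form_solution p q r a b x \<and> infinite {w. is_pole (hyp_f p q r a b x) w}"

text \<open>
  The lists \<open>us\<close> and \<open>vs\<close> are \<open>u\<^sub>1, \<dots>, u\<^sub>m\<close> and \<open>v\<^sub>1, \<dots>, v\<^sub>n\<close>; repetitions are allowed.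
\<close>

definition canonical_form ::
  "(complex \<Rightarrow> complex) \<Rightarrow> (complex \<Rightarrow> complex) \<Rightarrow> complex \<Rightarrow> complex list \<Rightarrow> complex list \<Rightarrow> bool" where
  "canonical_form R S d us vs \<longleftrightarrow>
     rational_fun S \<and> (\<forall>\<^sub>\<approx>w. S w \<noteq> 0) \<and> d \<noteq> 0 \<and>
     (\<forall>u \<in> set us. \<forall>v \<in> set vs. u - v \<notin> \<int>) \<and>
     (\<forall>\<^sub>\<approx>w. R w = S (w + 1) / S w * d * ((\<Prod>u\<leftarrow>us. w + u) / (\<Prod>v\<leftarrow>vs. w + v))) \<and>
     (real_rational_fun R \<longrightarrow>
        real_rational_fun S \<and> d \<in> \<real> \<and>
        real_rational_fun (\<lambda>w. \<Prod>u\<leftarrow>us. w + u) \<and> real_rational_fun (\<lambda>w. \<Prod>v\<leftarrow>vs. w + v))"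

text \<open>
  A canonical form is not unique, but since \<open>p\<close> and \<open>q\<close> are integers the condition on the \<open>u\<^sub>i\<close> does
  not depend on its choice: the \<open>u\<^sub>i\<close> are determined up to order and integer shifts.
\<close>

definition type_A ::
  "complex \<Rightarrow> complex \<Rightarrow> complex \<Rightarrow> complex \<Rightarrow> complex \<Rightarrow> complex \<Rightarrow> bool" where
  "type_A p q r a b x \<longleftrightarrow>
     non_elementary p q r a b x \<and>
     (\<exists>k l m :: int. p = of_int k \<and> q = of_int l \<and> r = of_int m \<and> m > 0 \<and> even (k + l + m)) \<and>
     (\<exists>S d us vs. canonical_form (hyp_ratio p q r a b x) S d us vs \<and>
        (\<forall>u \<in> set us. p * u - a \<in> \<real> - \<int> \<and> q * u - b \<in> \<real> - \<int>))"

section \<open>Contiguous relations\<close>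

text \<open>
  Polynomials in \<open>(\<alpha>, \<beta>; \<gamma>; z)\<close> as iterated univariate polynomials, with \<open>z\<close> the outermost and
  \<open>\<alpha>\<close> the innermost variable.
\<close>

type_synonym poly4 = "complex poly poly poly poly"

definition eval4 :: "poly4 \<Rightarrow> complex \<Rightarrow> complex \<Rightarrow> complex \<Rightarrow> complex \<Rightarrow> complex" where
  "eval4 P \<alpha> \<beta> \<gamma> z = poly (poly (poly (poly P [:[:[:z:]:]:]) [:[:\<gamma>:]:]) [:\<beta>:]) \<alpha>"

text \<open>
  The rational functions \<open>N\<^sub>R / D\<^sub>R\<close> and \<open>N\<^sub>Q / D\<^sub>Q\<close> in \<open>(\<alpha>, \<beta>; \<gamma>; z)\<close> are the coefficients
  \<open>R\<close> and \<open>Q\<close> of the three-term relation with shifts \<open>(p, q, r)\<close>. As rational functions they are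
  uniquely determined by \<open>(p, q, r)\<close>.
\<close>

definition three_term_relation ::
  "int \<Rightarrow> int \<Rightarrow> int \<Rightarrow> poly4 \<Rightarrow> poly4 \<Rightarrow> poly4 \<Rightarrow> poly4 \<Rightarrow> bool" where
  "three_term_relation p q r N\<^sub>R D\<^sub>R N\<^sub>Q D\<^sub>Q \<longleftrightarrow>
     D\<^sub>R \<noteq> 0 \<and> D\<^sub>Q \<noteq> 0 \<and>
     (\<forall>\<alpha> \<beta> \<gamma> z. norm z < 1 \<longrightarrow> \<gamma> \<notin> \<int>\<^sub>\<le>\<^sub>0 \<longrightarrow> \<gamma> + of_int r \<notin> \<int>\<^sub>\<le>\<^sub>0 \<longrightarrow>
        eval4 D\<^sub>R \<alpha> \<beta> \<gamma> z \<noteq> 0 \<longrightarrow> eval4 D\<^sub>Q \<alpha> \<beta> \<gamma> z \<noteq> 0 \<longrightarrow>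
        Gauss_2F1 (\<alpha> + of_int p) (\<beta> + of_int q) (\<gamma> + of_int r) z =
          eval4 N\<^sub>R \<alpha> \<beta> \<gamma> z / eval4 D\<^sub>R \<alpha> \<beta> \<gamma> z * Gauss_2F1 \<alpha> \<beta> \<gamma> z +
          eval4 N\<^sub>Q \<alpha> \<beta> \<gamma> z / eval4 D\<^sub>Q \<alpha> \<beta> \<gamma> z * Gauss_2F1 (\<alpha> + 1) (\<beta> + 1) (\<gamma> + 1) z)"

text \<open>
  \<open>Q(w)\<close> is the restriction of \<open>Q = N\<^sub>Q / D\<^sub>Q\<close> to \<open>(p w + a, q w + b; r w; x)\<close>. To restrict it, it has
  to be written with a denominator that does not vanish identically there; the result is
  independent of the fraction used.
\<close>

definition from_contiguous_relations ::
  "complex \<Rightarrow> complex \<Rightarrow> complex \<Rightarrow> complex \<Rightarrow> complex \<Rightarrow> complex \<Rightarrow> bool" where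
  "from_contiguous_relations p q r a b x \<longleftrightarrow>
     closed_form_solution p q r a b x \<and>
     (\<exists>k l m :: int. p = of_int k \<and> q = of_int l \<and> r = of_int m \<and>
        (\<exists>N\<^sub>R D\<^sub>R N\<^sub>Q D\<^sub>Q. three_term_relation k l m N\<^sub>R D\<^sub>R N\<^sub>Q D\<^sub>Q \<and>
           (\<forall>\<^sub>\<approx>w. eval4 D\<^sub>Q (p * w + a) (q * w + b) (r * w) x \<noteq> 0) \<and>
           (\<forall>\<^sub>\<approx>w. eval4 N\<^sub>Q (p * w + a) (q * w + b) (r * w) x /
                  eval4 D\<^sub>Q (p * w + a) (q * w + b) (r * w) x = 0)))"

end

theory Submission
  imports Defs "HOL-Real_Asymp.Real_Asymp"
begin

text \<open>
  Put \<open>F = {}\<^sub>2F\<^sub>1(\<alpha>, \<beta>; \<gamma>; x)\<close> and \<open>G = {}\<^sub>2F\<^sub>1(\<alpha> + 1, \<beta> + 1; \<gamma> + 1; x)\<close>, restricted to the line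
  \<open>\<alpha> = p w + a\<close>, \<open>\<beta> = q w + b\<close>, \<open>\<gamma> = r w\<close>. If \<open>Q(w)\<close> does not vanish identically, the three-term
  relation and the rationality of \<open>F(w + 1) / F(w)\<close> make \<open>G / F\<close> a rational function of \<open>w\<close>, which
  has one limit \<open>L\<close> at infinity. For \<open>w \<rightarrow> +\<infinity>\<close> positivity of hypergeometric series gives
  \<open>0 \<le> G / F \<le> \<gamma> / ((1 - x) \<beta>)\<close>, hence \<open>x L > - r / q\<close>. At the poles \<open>w = - j / r\<close> of \<open>F\<close>, of which
  there are infinitely many, \<open>G / F\<close> is the quotient of the residues; these are again
  hypergeometric series, and positivity gives \<open>x G / F \<le> j / \<beta>\<close>, hence \<open>x L \<le> - r / q\<close>.
\<close>

section \<open>Convergence and contiguous relations\<close>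

text \<open>The obstacle is to evaluate \<open>G / F\<close> at the poles of \<open>F\<close>, where
  the three-term relation itself is meaningless. Both series are therefore multiplied by the
  reciprocal Gamma function of their lower parameter. The products are entire in \<open>w\<close>,
  the relation extends to the poles by continuity, and a quotient of residues becomes a quotient of
  values.

  For \<open>x < 0\<close> the terms of a series with positive parameters alternate in sign, so
  positivity has to come from Euler's beta integral, which asks that one upper parameter lie
  strictly between 0 and the lower one. The inequalities between \<open>p\<close>, \<open>q\<close>
  and \<open>r\<close> provide this at both ends of the real line, on the left after the shift of
  the upper parameters by \<open>j + 1\<close>. Each of the two bounds is then a contiguous relation
  between three positive numbers; they exclude each other because \<open>x / (1 - x) > - 1\<close>.

  A three-term relation restricts to the line only if its denominator does not vanish identically
  there. The relation is therefore composed from single shifts, keeping track of the factors that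
  enter the denominator.\<close>

lemma hypergeo_ratio_bound:
  fixes R \<rho> :: real and z :: complex
  assumes "norm z < \<rho>"
  shows "\<forall>\<^sub>F n in sequentially. \<forall>\<alpha> \<beta> \<gamma>. norm \<alpha> \<le> R \<longrightarrow> norm \<beta> \<le> R \<longrightarrow> norm \<gamma> \<le> R \<longrightarrow>
           \<gamma> + of_nat n \<noteq> 0 \<and>
           norm ((\<alpha> + of_nat n) * (\<beta> + of_nat n) / ((\<gamma> + of_nat n) * of_nat (Suc n)) * z) \<le> \<rho>"
proof -
  \<comment> \<open>A majorant of the term ratio that depends only on \<open>R\<close>. This
    uniformity in the parameters later gives locally uniform convergence in \<open>w\<close>, not
    only convergence for fixed parameters.\<close>
  have lim: "(\<lambda>n. (R + real n)\<^sup>2 / ((real n - R) * real (Suc n)) * norm z) \<longlonglongrightarrow> norm z"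
  proof -
    have "(\<lambda>n. (R + real n)\<^sup>2 / ((real n - R) * real (Suc n))) \<longlonglongrightarrow> 1"
      by real_asymp
    from tendsto_mult_right[OF this, of "norm z"] show ?thesis by simp
  qed
  have "\<forall>\<^sub>F n in sequentially. (R + real n)\<^sup>2 / ((real n - R) * real (Suc n)) * norm z < \<rho>"
    using order_tendstoD(2)[OF lim assms] .
  moreover have "\<forall>\<^sub>F n in sequentially. real n > R"
    by real_asymp
  ultimately show ?thesis
  proof eventually_elim
    case (elim n)
    show ?case
    proof (intro allI impI)
      fix \<alpha> \<beta> \<gamma> :: complex
      assume *: "norm \<alpha> \<le> R" "norm \<beta> \<le> R" "norm \<gamma> \<le> R"
      have R: "R \<ge> 0" using *(1) norm_ge_zero order_trans by blast
      have a: "norm (\<alpha> + of_nat n) \<le> R + real n"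
        using norm_triangle_ineq[of \<alpha> "of_nat n"] * by simp
      have b: "norm (\<beta> + of_nat n) \<le> R + real n"
        using norm_triangle_ineq[of \<beta> "of_nat n"] * by simp
      have c: "norm (\<gamma> + of_nat n) \<ge> real n - R"
        using norm_diff_ineq[of "of_nat n" \<gamma>] * by (simp add: add.commute)
      have "norm ((\<alpha> + of_nat n) * (\<beta> + of_nat n) / ((\<gamma> + of_nat n) * of_nat (Suc n)) * z)
          = norm (\<alpha> + of_nat n) * norm (\<beta> + of_nat n) / (norm (\<gamma> + of_nat n) * real (Suc n)) * norm z"
        by (simp add: norm_mult norm_divide del: of_nat_Suc)
      also have "\<dots> \<le> (R + real n) * (R + real n) / ((real n - R) * real (Suc n)) * norm z"
        by (intro mult_right_mono frac_le mult_mono a b c) (use elim R in auto)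
      also have "\<dots> \<le> \<rho>"
        using elim by (simp add: power2_eq_square)
      moreover have "\<gamma> + of_nat n \<noteq> 0"
        using c elim by auto
      ultimately show "\<gamma> + of_nat n \<noteq> 0 \<and>
          norm ((\<alpha> + of_nat n) * (\<beta> + of_nat n) / ((\<gamma> + of_nat n) * of_nat (Suc n)) * z) \<le> \<rho>"
        by simp
    qed
  qed
qed

abbreviation fps_2F1 :: "complex \<Rightarrow> complex \<Rightarrow> complex \<Rightarrow> complex fps" where
  "fps_2F1 \<alpha> \<beta> \<gamma> \<equiv> fps_hypergeo [\<alpha>, \<beta>] [\<gamma>] 1"

lemma fps_2F1_nth:
  "fps_nth (fps_2F1 \<alpha> \<beta> \<gamma>) n = pochhammer \<alpha> n * pochhammer \<beta> n / (pochhammer \<gamma> n * fact n)"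
  by simp

text \<open>No condition on \<gamma> is needed: if \<open>\<gamma> + of_nat n = 0\<close>, then both
  sides are 0 by the convention for division by zero.\<close>

lemma fps_2F1_nth_Suc:
  "fps_nth (fps_2F1 \<alpha> \<beta> \<gamma>) (Suc n) = fps_nth (fps_2F1 \<alpha> \<beta> \<gamma>) n *
     ((\<alpha> + of_nat n) * (\<beta> + of_nat n) / ((\<gamma> + of_nat n) * of_nat (Suc n)))"
  unfolding fps_2F1_nth pochhammer_Suc fact_Suc times_divide_times_eq of_nat_mult
  by (simp only: mult_ac)

lemma summable_2F1:
  assumes "norm z < 1"
  shows "summable (\<lambda>n. norm (fps_nth (fps_2F1 \<alpha> \<beta> \<gamma>) n * z ^ n))"
proof -
  define \<rho> where "\<rho> = (norm z + 1) / 2"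
  have \<rho>: "norm z < \<rho>" "\<rho> < 1" using assms by (auto simp: \<rho>_def)
  define R where "R = max (norm \<alpha>) (max (norm \<beta>) (norm \<gamma>))"
  have R: "norm \<alpha> \<le> R" "norm \<beta> \<le> R" "norm \<gamma> \<le> R" by (auto simp: R_def)
  obtain N where N: "\<And>n. n \<ge> N \<Longrightarrow>
       norm ((\<alpha> + of_nat n) * (\<beta> + of_nat n) / ((\<gamma> + of_nat n) * of_nat (Suc n)) * z) \<le> \<rho>"
    using hypergeo_ratio_bound[OF \<rho>(1), of R] R unfolding eventually_sequentially by blast
  show ?thesis
  proof (rule summable_ratio_test[OF \<rho>(2)])
    fix n assume "n \<ge> N"
    have "fps_nth (fps_2F1 \<alpha> \<beta> \<gamma>) (Suc n) * z ^ Suc n = 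
         ((\<alpha> + of_nat n) * (\<beta> + of_nat n) / ((\<gamma> + of_nat n) * of_nat (Suc n)) * z) *
         (fps_nth (fps_2F1 \<alpha> \<beta> \<gamma>) n * z ^ n)"
      unfolding fps_2F1_nth_Suc by (simp add: mult_ac)
    also have "norm \<dots> \<le> \<rho> * norm (fps_nth (fps_2F1 \<alpha> \<beta> \<gamma>) n * z ^ n)"
      using mult_right_mono[OF N[OF \<open>n \<ge> N\<close>] norm_ge_zero[of "fps_nth (fps_2F1 \<alpha> \<beta> \<gamma>) n * z ^ n"]]
      by (simp only: norm_mult)
    finally show "norm (norm (fps_nth (fps_2F1 \<alpha> \<beta> \<gamma>) (Suc n) * z ^ Suc n))
        \<le> \<rho> * norm (norm (fps_nth (fps_2F1 \<alpha> \<beta> \<gamma>) n * z ^ n))" by simp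
  qed
qed

lemma fps_conv_radius_2F1: "fps_conv_radius (fps_2F1 \<alpha> \<beta> \<gamma>) \<ge> 1"
  unfolding fps_conv_radius_def
proof (rule conv_radius_geI_ex')
  fix r :: real assume "r > 0" "ereal r < 1"
  then have "norm (of_real r :: complex) < 1" by simp
  then show "summable (\<lambda>n. fps_nth (fps_2F1 \<alpha> \<beta> \<gamma>) n * of_real r ^ n)"
    by (rule summable_norm_cancel[OF summable_2F1])
qed

section \<open>Gauss's contiguous relations by comparison of coefficients\<close>

lemma pochhammer_nonzero:
  "(\<gamma> :: complex) \<notin> \<int>\<^sub>\<le>\<^sub>0 \<Longrightarrow> pochhammer \<gamma> n \<noteq> 0"
  using pochhammer_eq_0_imp_nonpos_Int by blast

lemma not_nonpos_Int_add_of_nat: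
  assumes "(\<gamma> :: complex) \<notin> \<int>\<^sub>\<le>\<^sub>0"
  shows "\<gamma> + of_nat n \<notin> \<int>\<^sub>\<le>\<^sub>0"
  using nonpos_Ints_diff_Nats[of "\<gamma> + of_nat n" "of_nat n"] assms by auto

lemma eval_fps_poly_times_2F1:
  assumes "norm z < 1"
  shows "eval_fps (fps_of_poly p * fps_2F1 \<alpha> \<beta> \<gamma>) z = poly p z * Gauss_2F1 \<alpha> \<beta> \<gamma> z"
    and "ereal (norm z) < fps_conv_radius (fps_of_poly p * fps_2F1 \<alpha> \<beta> \<gamma>)"
proof -
  have *: "ereal (norm z) < fps_conv_radius (fps_2F1 \<alpha> \<beta> \<gamma>)"
    using assms fps_conv_radius_2F1[of \<alpha> \<beta> \<gamma>] by (meson ereal_less(3) less_le_trans)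
  show "eval_fps (fps_of_poly p * fps_2F1 \<alpha> \<beta> \<gamma>) z = poly p z * Gauss_2F1 \<alpha> \<beta> \<gamma> z"
    using * by (simp add: eval_fps_mult Gauss_2F1_def)
  show "ereal (norm z) < fps_conv_radius (fps_of_poly p * fps_2F1 \<alpha> \<beta> \<gamma>)"
    by (rule less_le_trans[OF _ fps_conv_radius_mult]) (use * in simp)
qed

text \<open>Reduces a contiguous relation to an identity of formal power series; convergence is used
  only to evaluate that identity at \<open>z\<close>.\<close>

lemma Gauss_2F1_relation:
  assumes z: "norm z < 1"
    and eq: "fps_of_poly p\<^sub>1 * fps_2F1 a\<^sub>1 b\<^sub>1 c\<^sub>1 + fps_of_poly p\<^sub>2 * fps_2F1 a\<^sub>2 b\<^sub>2 c\<^sub>2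
         + fps_of_poly p\<^sub>3 * fps_2F1 a\<^sub>3 b\<^sub>3 c\<^sub>3 = 0"
  shows "poly p\<^sub>1 z * Gauss_2F1 a\<^sub>1 b\<^sub>1 c\<^sub>1 z + poly p\<^sub>2 z * Gauss_2F1 a\<^sub>2 b\<^sub>2 c\<^sub>2 z
       + poly p\<^sub>3 z * Gauss_2F1 a\<^sub>3 b\<^sub>3 c\<^sub>3 z = 0"
proof -
  have add: "eval_fps (f + g) z = eval_fps f z + eval_fps g z"
       "ereal (norm z) < fps_conv_radius (f + g)"
    if "ereal (norm z) < fps_conv_radius f" "ereal (norm z) < fps_conv_radius g" for f g :: "complex fps"
    using that eval_fps_add[of z f g] less_le_trans[OF _ fps_conv_radius_add[of f g]] by simp_all
  have "poly p\<^sub>1 z * Gauss_2F1 a\<^sub>1 b\<^sub>1 c\<^sub>1 z + poly p\<^sub>2 z * Gauss_2F1 a\<^sub>2 b\<^sub>2 c\<^sub>2 z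
       + poly p\<^sub>3 z * Gauss_2F1 a\<^sub>3 b\<^sub>3 c\<^sub>3 z = eval_fps 0 z"
    unfolding eq[symmetric] by (simp only: add eval_fps_poly_times_2F1[OF z])
  then show ?thesis
    by simp
qed

lemma Gauss_2F1_commute: "Gauss_2F1 \<alpha> \<beta> \<gamma> z = Gauss_2F1 \<beta> \<alpha> \<gamma> z"
  by (simp add: Gauss_2F1_altdef mult.commute)

lemma fps_2F1_pCons_nth:
  "fps_nth (fps_of_poly [:c:] * fps_2F1 \<alpha> \<beta> \<gamma>) n = c * fps_nth (fps_2F1 \<alpha> \<beta> \<gamma>) n"
  "fps_nth (fps_of_poly [:c, d:] * fps_2F1 \<alpha> \<beta> \<gamma>) (Suc n) =
     c * fps_nth (fps_2F1 \<alpha> \<beta> \<gamma>) (Suc n) + d * fps_nth (fps_2F1 \<alpha> \<beta> \<gamma>) n"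
  "fps_nth (fps_of_poly [:c, d, e:] * fps_2F1 \<alpha> \<beta> \<gamma>) (Suc (Suc n)) =
     c * fps_nth (fps_2F1 \<alpha> \<beta> \<gamma>) (Suc (Suc n)) + d * fps_nth (fps_2F1 \<alpha> \<beta> \<gamma>) (Suc n)
       + e * fps_nth (fps_2F1 \<alpha> \<beta> \<gamma>) n"
  by (simp_all add: fps_of_poly_pCons fps_of_poly_const distrib_right distrib_left mult.assoc
        del: fps_hypergeo_nth)

text \<open>Brings all symbols to the form \<open>pochhammer (x + 1) m\<close>, so that equality of
  coefficients becomes an identity of rational expressions.\<close>

lemma pochhammer_shift:
  fixes x :: complex
  shows "pochhammer x (Suc m) = x * pochhammer (x + 1) m"
    and "pochhammer (x + 1) (Suc m) = pochhammer (x + 1) m * (x + 1 + of_nat m)"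
    and "fact (Suc m) = (1 + of_nat m) * (fact m :: complex)"
  by (rule pochhammer_rec, rule pochhammer_Suc) simp

lemma lower_param_nonzero:
  fixes \<gamma> :: complex
  assumes "\<gamma> \<notin> \<int>\<^sub>\<le>\<^sub>0"
  shows "\<gamma> \<noteq> 0" "pochhammer (\<gamma> + 1) m \<noteq> 0" "\<gamma> + 1 + of_nat m \<noteq> 0" "1 + of_nat m \<noteq> (0 :: complex)"
proof -
  show "\<gamma> \<noteq> 0"
    using assms by auto
  show "pochhammer (\<gamma> + 1) m \<noteq> 0"
    using pochhammer_nonzero[OF assms, of "Suc m"] by (simp add: pochhammer_rec)
  show "\<gamma> + 1 + of_nat m \<noteq> 0"
    using not_nonpos_Int_add_of_nat[OF assms, of "Suc m"] by (auto simp: add.assoc)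
  show "1 + of_nat m \<noteq> (0 :: complex)"
    using of_nat_neq_0[of m] by simp
qed

text \<open>With the Euler operator \<open>z d/dz\<close>, this combines
  \<open>(z d/dz + \<alpha>) F = \<alpha> F(\<alpha> + 1)\<close> with the fact that
  \<open>F'\<close> is \<open>\<alpha> \<beta> / \<gamma>\<close> times the diagonal neighbour,
  after cancelling \<alpha>.\<close>

lemma Gauss_2F1_contiguous_upper:
  assumes "norm z < 1" "\<gamma> \<notin> \<int>\<^sub>\<le>\<^sub>0"
  shows "\<gamma> * Gauss_2F1 (\<alpha> + 1) \<beta> \<gamma> z =
           \<gamma> * Gauss_2F1 \<alpha> \<beta> \<gamma> z + \<beta> * z * Gauss_2F1 (\<alpha> + 1) (\<beta> + 1) (\<gamma> + 1) z"
proof -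
  have "fps_of_poly [:\<gamma>:] * fps_2F1 (\<alpha> + 1) \<beta> \<gamma> + fps_of_poly [:-\<gamma>:] * fps_2F1 \<alpha> \<beta> \<gamma>
         + fps_of_poly [:0, -\<beta>:] * fps_2F1 (\<alpha> + 1) (\<beta> + 1) (\<gamma> + 1) = 0" (is "?F = 0")
  proof (rule fps_ext)
    fix n show "fps_nth ?F n = fps_nth 0 n"
    proof (cases n)
      case 0 then show ?thesis by simp
    next
      case (Suc m)
      define A B G where "A = pochhammer (\<alpha> + 1) m" and "B = pochhammer (\<beta> + 1) m" and "G = pochhammer (\<gamma> + 1) m"
      show ?thesis
        \<comment> \<open>The rule for \<open>x + 1\<close> has to act first: the general recursion
          would also match there and produce symbols at \<open>x + 1 + 1\<close>.\<close>
        unfolding Suc fps_add_nth fps_2F1_pCons_nth fps_2F1_nth pochhammer_shift(2,3)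
        unfolding pochhammer_shift(1) A_def[symmetric] B_def[symmetric] G_def[symmetric]
        using lower_param_nonzero(1)[OF assms(2)] lower_param_nonzero(2-4)[OF assms(2), where m = m, folded G_def] by (simp add: divide_simps) algebra
    qed
  qed
  from Gauss_2F1_relation[OF assms(1) this] show ?thesis
    by (simp add: algebra_simps)
qed

text \<open>This is the hypergeometric differential equation: the two diagonal neighbours are
  multiples of the first and second derivatives of \<open>F\<close>.\<close>

lemma Gauss_2F1_contiguous_diagonal:
  assumes "norm z < 1" "\<gamma> \<notin> \<int>\<^sub>\<le>\<^sub>0"
  shows "z * (1 - z) * (\<alpha> + 1) * (\<beta> + 1) * Gauss_2F1 (\<alpha> + 2) (\<beta> + 2) (\<gamma> + 2) z =
           \<gamma> * (\<gamma> + 1) * Gauss_2F1 \<alpha> \<beta> \<gamma> z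
           - (\<gamma> + 1) * (\<gamma> - (\<alpha> + \<beta> + 1) * z) * Gauss_2F1 (\<alpha> + 1) (\<beta> + 1) (\<gamma> + 1) z"
proof -
  have "fps_of_poly [:\<gamma> * (\<gamma> + 1):] * fps_2F1 \<alpha> \<beta> \<gamma>
         + fps_of_poly [:- (\<gamma> + 1) * \<gamma>, (\<gamma> + 1) * (\<alpha> + \<beta> + 1):] * fps_2F1 (\<alpha> + 1) (\<beta> + 1) (\<gamma> + 1)
         + fps_of_poly [:0, - ((\<alpha> + 1) * (\<beta> + 1)), (\<alpha> + 1) * (\<beta> + 1):]
             * fps_2F1 (\<alpha> + 2) (\<beta> + 2) (\<gamma> + 2) = 0" (is "?F = 0")
  proof (rule fps_ext)
    fix n show "fps_nth ?F n = fps_nth 0 n"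
    proof (cases n)
      case 0 then show ?thesis by (simp add: algebra_simps)
    next
      case Suc1: (Suc k)
      show ?thesis
      proof (cases k)
        \<comment> \<open>The coefficient of index 1 is separate, because the rule for a quadratic
          factor starts at index 2.\<close>
        case 0
        have nz: "\<gamma> \<noteq> 0" "\<gamma> + 1 \<noteq> 0"
          using assms(2) pochhammer_nonzero[OF assms(2), of 2] by (auto simp: pochhammer_rec numeral_2_eq_2)
        have e: "fps_nth (fps_of_poly [:c, d, e:] * F) (Suc 0) = c * fps_nth F 1 + d * fps_nth F 0"
          for c d e and F :: "complex fps"
          by (simp add: fps_of_poly_pCons fps_of_poly_const distrib_right mult.assoc)
        show ?thesis
          unfolding Suc1 0 fps_add_nth fps_2F1_pCons_nth e fps_2F1_nth
          using nz by (simp add: divide_simps) algebra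
      next
        case (Suc m)
        have nz: "\<gamma> \<noteq> 0" "\<gamma> + 1 \<noteq> 0" "pochhammer (\<gamma> + 2) m \<noteq> 0" "\<gamma> + 2 + of_nat m \<noteq> 0"
            "1 + of_nat m \<noteq> (0::complex)" "2 + of_nat m \<noteq> (0::complex)"
        proof -
          have \<gamma>': "\<gamma> + 1 \<notin> \<int>\<^sub>\<le>\<^sub>0"
            using not_nonpos_Int_add_of_nat[OF assms(2), of 1] by simp
          show "\<gamma> \<noteq> 0" "\<gamma> + 1 \<noteq> 0" "pochhammer (\<gamma> + 2) m \<noteq> 0" "\<gamma> + 2 + of_nat m \<noteq> 0"
            "1 + of_nat m \<noteq> (0::complex)" "2 + of_nat m \<noteq> (0::complex)"
            using lower_param_nonzero(1)[OF assms(2)] lower_param_nonzero(2-4)[OF assms(2), where m = m] lower_param_nonzero(1)[OF \<gamma>'] lower_param_nonzero(2-4)[OF \<gamma>', where m = m]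
              of_nat_neq_0[of "Suc m", where 'a = complex]
            by (simp_all add: add.assoc)
        qed
        have r: "pochhammer x (Suc (Suc m)) = x * (x + 1) * pochhammer (x + 2) m"
          "pochhammer (x + 1) (Suc (Suc m)) = (x + 1) * (pochhammer (x + 2) m * (x + 2 + of_nat m))"
          "pochhammer (x + 1) (Suc m) = (x + 1) * pochhammer (x + 2) m"
          "pochhammer (x + 2) (Suc m) = pochhammer (x + 2) m * (x + 2 + of_nat m)" for x :: complex
             apply (simp add: pochhammer_rec add.assoc)
            apply (subst pochhammer_rec, subst pochhammer_Suc, simp add: add.assoc)
           apply (subst pochhammer_rec, simp add: add.assoc)
          apply (rule pochhammer_Suc)
          done
        have f: "fact (Suc (Suc m)) = (2 + of_nat m) * ((1 + of_nat m) * (fact m :: complex))"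
            "fact (Suc m) = (1 + of_nat m) * (fact m :: complex)"
          by (simp_all add: algebra_simps)
        define A B G where "A = pochhammer (\<alpha> + 2) m" and "B = pochhammer (\<beta> + 2) m" and "G = pochhammer (\<gamma> + 2) m"
        show ?thesis
          unfolding Suc Suc1 fps_add_nth fps_2F1_pCons_nth fps_2F1_nth r(2-4) f
          unfolding r(1) A_def[symmetric] B_def[symmetric] G_def[symmetric]
          using nz[folded G_def] by (simp add: divide_simps) algebra
      qed
    qed
  qed
  from Gauss_2F1_relation[OF assms(1) this] show ?thesis
    by (simp add: algebra_simps power2_eq_square)
qed

text \<open>Equivalent to the formula for the derivative of \<open>(1 - z)\<close> to the power
  \<open>\<alpha> + \<beta> - \<gamma>\<close> times \<open>F\<close>, which raises the lower
  parameter.\<close>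

lemma Gauss_2F1_contiguous_lower:
  assumes "norm z < 1" "\<gamma> \<notin> \<int>\<^sub>\<le>\<^sub>0"
  shows "(\<gamma> - \<alpha>) * (\<gamma> - \<beta>) * Gauss_2F1 \<alpha> \<beta> (\<gamma> + 1) z =
           \<alpha> * \<beta> * (1 - z) * Gauss_2F1 (\<alpha> + 1) (\<beta> + 1) (\<gamma> + 1) z
           + \<gamma> * (\<gamma> - \<alpha> - \<beta>) * Gauss_2F1 \<alpha> \<beta> \<gamma> z"
proof -
  have "fps_of_poly [:(\<gamma> - \<alpha>) * (\<gamma> - \<beta>):] * fps_2F1 \<alpha> \<beta> (\<gamma> + 1)
         + fps_of_poly [:- (\<gamma> * (\<gamma> - \<alpha> - \<beta>)):] * fps_2F1 \<alpha> \<beta> \<gamma>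
         + fps_of_poly [:- (\<alpha> * \<beta>), \<alpha> * \<beta>:] * fps_2F1 (\<alpha> + 1) (\<beta> + 1) (\<gamma> + 1) = 0" (is "?F = 0")
  proof (rule fps_ext)
    fix n show "fps_nth ?F n = fps_nth 0 n"
    proof (cases n)
      case 0 then show ?thesis by (simp add: algebra_simps)
    next
      case (Suc m)
      define A B G where "A = pochhammer (\<alpha> + 1) m" and "B = pochhammer (\<beta> + 1) m" and "G = pochhammer (\<gamma> + 1) m"
      show ?thesis
        unfolding Suc fps_add_nth fps_2F1_pCons_nth fps_2F1_nth pochhammer_shift(2,3)
        unfolding pochhammer_shift(1) A_def[symmetric] B_def[symmetric] G_def[symmetric]
        using lower_param_nonzero(1)[OF assms(2)] lower_param_nonzero(2-4)[OF assms(2), where m = m, folded G_def] by (simp add: divide_simps) algebra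
    qed
  qed
  from Gauss_2F1_relation[OF assms(1) this] show ?thesis
    by (simp add: algebra_simps)
qed

text \<open>Source of the upper bound for \<open>G / F\<close> on the right: the right-hand side is
  positive there, so the difference on the left is too.\<close>

lemma Gauss_2F1_contiguous_euler:
  assumes "norm z < 1" "\<gamma> \<notin> \<int>\<^sub>\<le>\<^sub>0"
  shows "\<gamma> * Gauss_2F1 \<alpha> \<beta> \<gamma> z - (1 - z) * \<beta> * Gauss_2F1 (\<alpha> + 1) (\<beta> + 1) (\<gamma> + 1) z =
           (\<gamma> - \<beta>) * Gauss_2F1 (\<alpha> + 1) \<beta> (\<gamma> + 1) z"
proof -
  have "fps_of_poly [:\<gamma>:] * fps_2F1 \<alpha> \<beta> \<gamma>
         + fps_of_poly [:\<beta> - \<gamma>:] * fps_2F1 (\<alpha> + 1) \<beta> (\<gamma> + 1)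
         + fps_of_poly [:- \<beta>, \<beta>:] * fps_2F1 (\<alpha> + 1) (\<beta> + 1) (\<gamma> + 1) = 0" (is "?F = 0")
  proof (rule fps_ext)
    fix n show "fps_nth ?F n = fps_nth 0 n"
    proof (cases n)
      case 0 then show ?thesis by (simp add: algebra_simps)
    next
      case (Suc m)
      define A B G where "A = pochhammer (\<alpha> + 1) m" and "B = pochhammer (\<beta> + 1) m" and "G = pochhammer (\<gamma> + 1) m"
      show ?thesis
        unfolding Suc fps_add_nth fps_2F1_pCons_nth fps_2F1_nth pochhammer_shift(2,3)
        unfolding pochhammer_shift(1) A_def[symmetric] B_def[symmetric] G_def[symmetric]
        using lower_param_nonzero(1)[OF assms(2)] lower_param_nonzero(2-4)[OF assms(2), where m = m, folded G_def] by (simp add: divide_simps) algebra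
    qed
  qed
  from Gauss_2F1_relation[OF assms(1) this] show ?thesis
    by (simp add: algebra_simps)
qed

text \<open>Plays the same part for the bound at the poles, applied to the shifted series that
  represent the residues.\<close>

lemma Gauss_2F1_contiguous_upper_lower:
  assumes "norm z < 1" "\<gamma> \<notin> \<int>\<^sub>\<le>\<^sub>0"
  shows "\<gamma> * Gauss_2F1 \<alpha> \<beta> \<gamma> z - (\<gamma> - \<alpha>) * Gauss_2F1 \<alpha> \<beta> (\<gamma> + 1) z =
           \<alpha> * Gauss_2F1 (\<alpha> + 1) \<beta> (\<gamma> + 1) z"
proof -
  have "fps_of_poly [:\<gamma>:] * fps_2F1 \<alpha> \<beta> \<gamma>
         + fps_of_poly [:\<alpha> - \<gamma>:] * fps_2F1 \<alpha> \<beta> (\<gamma> + 1)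
         + fps_of_poly [:- \<alpha>:] * fps_2F1 (\<alpha> + 1) \<beta> (\<gamma> + 1) = 0" (is "?F = 0")
  proof (rule fps_ext)
    fix n show "fps_nth ?F n = fps_nth 0 n"
    proof (cases n)
      case 0 then show ?thesis by (simp add: algebra_simps)
    next
      case (Suc m)
      define A B G where "A = pochhammer (\<alpha> + 1) m" and "B = pochhammer (\<beta> + 1) m" and "G = pochhammer (\<gamma> + 1) m"
      show ?thesis
        unfolding Suc fps_add_nth fps_2F1_pCons_nth fps_2F1_nth pochhammer_shift(2,3)
        unfolding pochhammer_shift(1) A_def[symmetric] B_def[symmetric] G_def[symmetric]
        using lower_param_nonzero(1)[OF assms(2)] lower_param_nonzero(2-4)[OF assms(2), where m = m, folded G_def] by (simp add: divide_simps) algebra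
    qed
  qed
  from Gauss_2F1_relation[OF assms(1) this] show ?thesis
    by (simp add: algebra_simps)
qed

section \<open>Existence of three-term relations\<close>

lemma poly_cosparse_nonzero:
  fixes T :: "complex poly"
  assumes "T \<noteq> 0"
  shows "\<forall>\<^sub>\<approx>w. poly T w \<noteq> 0"
  unfolding eventually_cosparse
  using finite_imp_sparse[OF poly_roots_finite[OF assms]] by simp

lemma linear_cosparse_nonzero:
  fixes c d :: complex
  assumes "c \<noteq> 0"
  shows "\<forall>\<^sub>\<approx>w. c * w + d \<noteq> 0"
  using poly_cosparse_nonzero[of "[:d, c:]"] assms by (simp add: algebra_simps)

text \<open>Stated for functions rather than for iterated polynomials, so that the explicit
  coefficients of the contiguous relations are recognised by closure rules.\<close>

definition poly4_fun :: "(complex \<Rightarrow> complex \<Rightarrow> complex \<Rightarrow> complex \<Rightarrow> complex) \<Rightarrow> bool" where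
  "poly4_fun h \<longleftrightarrow> (\<exists>P. \<forall>\<alpha> \<beta> \<gamma> z. h \<alpha> \<beta> \<gamma> z = eval4 P \<alpha> \<beta> \<gamma> z)"

named_theorems poly4_intros

lemma poly4_fun_const [poly4_intros]: "poly4_fun (\<lambda>\<alpha> \<beta> \<gamma> z. c)"
  unfolding poly4_fun_def by (rule exI[of _ "[:[:[:[:c:]:]:]:]"]) (simp add: eval4_def)

lemma poly4_fun_vars [poly4_intros]:
  "poly4_fun (\<lambda>\<alpha> \<beta> \<gamma> z. \<alpha>)" "poly4_fun (\<lambda>\<alpha> \<beta> \<gamma> z. \<beta>)"
  "poly4_fun (\<lambda>\<alpha> \<beta> \<gamma> z. \<gamma>)" "poly4_fun (\<lambda>\<alpha> \<beta> \<gamma> z. z)"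
  unfolding poly4_fun_def
     apply (rule exI[of _ "[:[:[:[:0, 1:]:]:]:]"], simp add: eval4_def)
    apply (rule exI[of _ "[:[:[:0, 1:]:]:]"], simp add: eval4_def)
   apply (rule exI[of _ "[:[:0, 1:]:]"], simp add: eval4_def)
  apply (rule exI[of _ "[:0, 1:]"], simp add: eval4_def)
  done

lemma poly4_fun_add [poly4_intros]:
  assumes "poly4_fun g" "poly4_fun h"
  shows "poly4_fun (\<lambda>\<alpha> \<beta> \<gamma> z. g \<alpha> \<beta> \<gamma> z + h \<alpha> \<beta> \<gamma> z)"
proof -
  from assms obtain P Q where "\<forall>\<alpha> \<beta> \<gamma> z. g \<alpha> \<beta> \<gamma> z = eval4 P \<alpha> \<beta> \<gamma> z"
      "\<forall>\<alpha> \<beta> \<gamma> z. h \<alpha> \<beta> \<gamma> z = eval4 Q \<alpha> \<beta> \<gamma> z" unfolding poly4_fun_def by blast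
  then show ?thesis unfolding poly4_fun_def by (intro exI[of _ "P + Q"]) (simp add: eval4_def)
qed

lemma poly4_fun_diff [poly4_intros]:
  assumes "poly4_fun g" "poly4_fun h"
  shows "poly4_fun (\<lambda>\<alpha> \<beta> \<gamma> z. g \<alpha> \<beta> \<gamma> z - h \<alpha> \<beta> \<gamma> z)"
proof -
  from assms obtain P Q where "\<forall>\<alpha> \<beta> \<gamma> z. g \<alpha> \<beta> \<gamma> z = eval4 P \<alpha> \<beta> \<gamma> z"
      "\<forall>\<alpha> \<beta> \<gamma> z. h \<alpha> \<beta> \<gamma> z = eval4 Q \<alpha> \<beta> \<gamma> z" unfolding poly4_fun_def by blast
  then show ?thesis unfolding poly4_fun_def by (intro exI[of _ "P - Q"]) (simp add: eval4_def)
qed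

lemma poly4_fun_mult [poly4_intros]:
  assumes "poly4_fun g" "poly4_fun h"
  shows "poly4_fun (\<lambda>\<alpha> \<beta> \<gamma> z. g \<alpha> \<beta> \<gamma> z * h \<alpha> \<beta> \<gamma> z)"
proof -
  from assms obtain P Q where "\<forall>\<alpha> \<beta> \<gamma> z. g \<alpha> \<beta> \<gamma> z = eval4 P \<alpha> \<beta> \<gamma> z"
      "\<forall>\<alpha> \<beta> \<gamma> z. h \<alpha> \<beta> \<gamma> z = eval4 Q \<alpha> \<beta> \<gamma> z" unfolding poly4_fun_def by blast
  then show ?thesis unfolding poly4_fun_def by (intro exI[of _ "P * Q"]) (simp add: eval4_def)
qed

text \<open>
  A fixed line \<open>(p w + a, q w + b; r w; x)\<close> determines which denominators are allowed: those
  that do not vanish identically on it.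
\<close>

context
  fixes p q r a b x :: complex
  assumes p: "p \<noteq> 0" and q: "q \<noteq> 0" and r: "r \<noteq> 0" and rp: "r \<noteq> p" and rq: "r \<noteq> q"
    and x: "x \<noteq> 0" "x \<noteq> 1"
begin

definition allowed_denom :: "(complex \<Rightarrow> complex \<Rightarrow> complex \<Rightarrow> complex \<Rightarrow> complex) \<Rightarrow> bool" where
  "allowed_denom h \<longleftrightarrow> (\<forall>\<^sub>\<approx>w. h (p * w + a) (q * w + b) (r * w) x \<noteq> 0)"

text \<open>The denominator is multiplied out, so the identity also holds at the zeros of
  \<open>D\<close>.\<close>

definition contiguous_span :: "(complex \<Rightarrow> complex \<Rightarrow> complex \<Rightarrow> complex \<Rightarrow> complex) \<Rightarrow> bool" where
  "contiguous_span G \<longleftrightarrow> (\<exists>D N\<^sub>1 N\<^sub>2. poly4_fun D \<and> poly4_fun N\<^sub>1 \<and> poly4_fun N\<^sub>2 \<and> allowed_denom D \<and>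
     (\<forall>\<alpha> \<beta> \<gamma> z. norm z < 1 \<longrightarrow> \<gamma> \<notin> \<int>\<^sub>\<le>\<^sub>0 \<longrightarrow>
        D \<alpha> \<beta> \<gamma> z * G \<alpha> \<beta> \<gamma> z = N\<^sub>1 \<alpha> \<beta> \<gamma> z * Gauss_2F1 \<alpha> \<beta> \<gamma> z
          + N\<^sub>2 \<alpha> \<beta> \<gamma> z * Gauss_2F1 (\<alpha> + 1) (\<beta> + 1) (\<gamma> + 1) z))"

lemma allowed_denom_mult:
  assumes "allowed_denom g" "allowed_denom h"
  shows "allowed_denom (\<lambda>\<alpha> \<beta> \<gamma> z. g \<alpha> \<beta> \<gamma> z * h \<alpha> \<beta> \<gamma> z)"
  using assms unfolding allowed_denom_def by eventually_elim simp

text \<open>These are the factors by which the contiguous relations are divided. Each hypothesis of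
  the context keeps one of them from vanishing identically on the line.\<close>

lemma allowed_denom_linear:
  "allowed_denom (\<lambda>\<alpha> \<beta> \<gamma> z. \<alpha> + c)" "allowed_denom (\<lambda>\<alpha> \<beta> \<gamma> z. \<beta> + c)"
  "allowed_denom (\<lambda>\<alpha> \<beta> \<gamma> z. \<gamma> + c)" "allowed_denom (\<lambda>\<alpha> \<beta> \<gamma> z. z * (1 - z))"
  "allowed_denom (\<lambda>\<alpha> \<beta> \<gamma> z. (\<gamma> - \<alpha>) + c)" "allowed_denom (\<lambda>\<alpha> \<beta> \<gamma> z. (\<gamma> - \<beta>) + c)"
proof -
  show "allowed_denom (\<lambda>\<alpha> \<beta> \<gamma> z. \<alpha> + c)"
    using linear_cosparse_nonzero[OF p, of "a + c"] by (simp add: allowed_denom_def add.assoc)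
  show "allowed_denom (\<lambda>\<alpha> \<beta> \<gamma> z. \<beta> + c)"
    using linear_cosparse_nonzero[OF q, of "b + c"] by (simp add: allowed_denom_def add.assoc)
  show "allowed_denom (\<lambda>\<alpha> \<beta> \<gamma> z. \<gamma> + c)"
    using linear_cosparse_nonzero[OF r, of c] by (simp add: allowed_denom_def)
  show "allowed_denom (\<lambda>\<alpha> \<beta> \<gamma> z. z * (1 - z))"
    using x by (simp add: allowed_denom_def)
  show "allowed_denom (\<lambda>\<alpha> \<beta> \<gamma> z. (\<gamma> - \<alpha>) + c)"
    using linear_cosparse_nonzero[of "r - p" "c - a"] rp by (simp add: allowed_denom_def algebra_simps)
  show "allowed_denom (\<lambda>\<alpha> \<beta> \<gamma> z. (\<gamma> - \<beta>) + c)"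
    using linear_cosparse_nonzero[of "r - q" "c - b"] rq by (simp add: allowed_denom_def algebra_simps)
qed

text \<open>Closure of the span under linear combinations with polynomial coefficients and under
  division by an allowed denominator; the common denominator is the product of all three.\<close>

lemma contiguous_span_comb:
  assumes G: "contiguous_span G\<^sub>1" "contiguous_span G\<^sub>2"
    and poly: "poly4_fun E" "poly4_fun A" "poly4_fun B" and E: "allowed_denom E"
    and eq: "\<And>\<alpha> \<beta> \<gamma> z. norm z < 1 \<Longrightarrow> \<gamma> \<notin> \<int>\<^sub>\<le>\<^sub>0 \<Longrightarrow>
        E \<alpha> \<beta> \<gamma> z * H \<alpha> \<beta> \<gamma> z = A \<alpha> \<beta> \<gamma> z * G\<^sub>1 \<alpha> \<beta> \<gamma> z + B \<alpha> \<beta> \<gamma> z * G\<^sub>2 \<alpha> \<beta> \<gamma> z"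
  shows "contiguous_span H"
proof -
  obtain D N\<^sub>1 N\<^sub>2 where 1: "poly4_fun D" "poly4_fun N\<^sub>1" "poly4_fun N\<^sub>2" "allowed_denom D"
     "\<And>\<alpha> \<beta> \<gamma> z. norm z < 1 \<Longrightarrow> \<gamma> \<notin> \<int>\<^sub>\<le>\<^sub>0 \<Longrightarrow>
        D \<alpha> \<beta> \<gamma> z * G\<^sub>1 \<alpha> \<beta> \<gamma> z = N\<^sub>1 \<alpha> \<beta> \<gamma> z * Gauss_2F1 \<alpha> \<beta> \<gamma> z
          + N\<^sub>2 \<alpha> \<beta> \<gamma> z * Gauss_2F1 (\<alpha> + 1) (\<beta> + 1) (\<gamma> + 1) z"
    using G(1) unfolding contiguous_span_def by blast
  obtain D' N\<^sub>1' N\<^sub>2' where 2: "poly4_fun D'" "poly4_fun N\<^sub>1'" "poly4_fun N\<^sub>2'" "allowed_denom D'"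
     "\<And>\<alpha> \<beta> \<gamma> z. norm z < 1 \<Longrightarrow> \<gamma> \<notin> \<int>\<^sub>\<le>\<^sub>0 \<Longrightarrow>
        D' \<alpha> \<beta> \<gamma> z * G\<^sub>2 \<alpha> \<beta> \<gamma> z = N\<^sub>1' \<alpha> \<beta> \<gamma> z * Gauss_2F1 \<alpha> \<beta> \<gamma> z
          + N\<^sub>2' \<alpha> \<beta> \<gamma> z * Gauss_2F1 (\<alpha> + 1) (\<beta> + 1) (\<gamma> + 1) z"
    using G(2) unfolding contiguous_span_def by blast
  show ?thesis
    unfolding contiguous_span_def
  proof (intro exI conjI allI impI)
    show "poly4_fun (\<lambda>\<alpha> \<beta> \<gamma> z. E \<alpha> \<beta> \<gamma> z * (D \<alpha> \<beta> \<gamma> z * D' \<alpha> \<beta> \<gamma> z))"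
      by (intro poly4_fun_mult 1 2 poly)
    show "poly4_fun (\<lambda>\<alpha> \<beta> \<gamma> z. A \<alpha> \<beta> \<gamma> z * (D' \<alpha> \<beta> \<gamma> z * N\<^sub>1 \<alpha> \<beta> \<gamma> z)
              + B \<alpha> \<beta> \<gamma> z * (D \<alpha> \<beta> \<gamma> z * N\<^sub>1' \<alpha> \<beta> \<gamma> z))"
      by (intro poly4_fun_mult poly4_fun_add 1 2 poly)
    show "poly4_fun (\<lambda>\<alpha> \<beta> \<gamma> z. A \<alpha> \<beta> \<gamma> z * (D' \<alpha> \<beta> \<gamma> z * N\<^sub>2 \<alpha> \<beta> \<gamma> z)
              + B \<alpha> \<beta> \<gamma> z * (D \<alpha> \<beta> \<gamma> z * N\<^sub>2' \<alpha> \<beta> \<gamma> z))"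
      by (intro poly4_fun_mult poly4_fun_add 1 2 poly)
    show "allowed_denom (\<lambda>\<alpha> \<beta> \<gamma> z. E \<alpha> \<beta> \<gamma> z * (D \<alpha> \<beta> \<gamma> z * D' \<alpha> \<beta> \<gamma> z))"
      by (intro allowed_denom_mult 1 2 E)
    fix \<alpha> \<beta> \<gamma> z :: complex
    assume z: "norm z < 1" "\<gamma> \<notin> \<int>\<^sub>\<le>\<^sub>0"
    show "E \<alpha> \<beta> \<gamma> z * (D \<alpha> \<beta> \<gamma> z * D' \<alpha> \<beta> \<gamma> z) * H \<alpha> \<beta> \<gamma> z =
        (A \<alpha> \<beta> \<gamma> z * (D' \<alpha> \<beta> \<gamma> z * N\<^sub>1 \<alpha> \<beta> \<gamma> z)
              + B \<alpha> \<beta> \<gamma> z * (D \<alpha> \<beta> \<gamma> z * N\<^sub>1' \<alpha> \<beta> \<gamma> z)) * Gauss_2F1 \<alpha> \<beta> \<gamma> z +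
        (A \<alpha> \<beta> \<gamma> z * (D' \<alpha> \<beta> \<gamma> z * N\<^sub>2 \<alpha> \<beta> \<gamma> z)
              + B \<alpha> \<beta> \<gamma> z * (D \<alpha> \<beta> \<gamma> z * N\<^sub>2' \<alpha> \<beta> \<gamma> z)) * Gauss_2F1 (\<alpha> + 1) (\<beta> + 1) (\<gamma> + 1) z"
      using 1(5)[OF z, of \<alpha> \<beta>] 2(5)[OF z, of \<alpha> \<beta>] eq[OF z, of \<alpha> \<beta>] by algebra
  qed
qed

text \<open>A series and its diagonal neighbour are carried together, because each contiguous
  relation expresses a single shift through exactly such a pair.\<close>

definition contiguous_pair :: "nat \<Rightarrow> nat \<Rightarrow> nat \<Rightarrow> bool" where
  "contiguous_pair i j k \<longleftrightarrow>
     contiguous_span (\<lambda>\<alpha> \<beta> \<gamma>. Gauss_2F1 (\<alpha> + of_nat i) (\<beta> + of_nat j) (\<gamma> + of_nat k)) \<and>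
     contiguous_span (\<lambda>\<alpha> \<beta> \<gamma>. Gauss_2F1 (\<alpha> + of_nat i + 1) (\<beta> + of_nat j + 1) (\<gamma> + of_nat k + 1))"

lemma contiguous_pair_0: "contiguous_pair 0 0 0"
  unfolding contiguous_pair_def contiguous_span_def
proof (intro conjI)
  have one: "allowed_denom (\<lambda>\<alpha> \<beta> \<gamma> z. 1)" by (simp add: allowed_denom_def)
  show "\<exists>D N\<^sub>1 N\<^sub>2. poly4_fun D \<and> poly4_fun N\<^sub>1 \<and> poly4_fun N\<^sub>2 \<and> allowed_denom D \<and>
     (\<forall>\<alpha> \<beta> \<gamma> z. norm z < 1 \<longrightarrow> \<gamma> \<notin> \<int>\<^sub>\<le>\<^sub>0 \<longrightarrow>
        D \<alpha> \<beta> \<gamma> z * Gauss_2F1 (\<alpha> + of_nat 0) (\<beta> + of_nat 0) (\<gamma> + of_nat 0) z =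
          N\<^sub>1 \<alpha> \<beta> \<gamma> z * Gauss_2F1 \<alpha> \<beta> \<gamma> z
          + N\<^sub>2 \<alpha> \<beta> \<gamma> z * Gauss_2F1 (\<alpha> + 1) (\<beta> + 1) (\<gamma> + 1) z)"
    by (intro exI[of _ "\<lambda>\<alpha> \<beta> \<gamma> z. 1"] exI[of _ "\<lambda>\<alpha> \<beta> \<gamma> z. 0"])
       (auto intro: one poly4_fun_const)
  show "\<exists>D N\<^sub>1 N\<^sub>2. poly4_fun D \<and> poly4_fun N\<^sub>1 \<and> poly4_fun N\<^sub>2 \<and> allowed_denom D \<and>
     (\<forall>\<alpha> \<beta> \<gamma> z. norm z < 1 \<longrightarrow> \<gamma> \<notin> \<int>\<^sub>\<le>\<^sub>0 \<longrightarrow>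
        D \<alpha> \<beta> \<gamma> z * Gauss_2F1 (\<alpha> + of_nat 0 + 1) (\<beta> + of_nat 0 + 1) (\<gamma> + of_nat 0 + 1) z =
          N\<^sub>1 \<alpha> \<beta> \<gamma> z * Gauss_2F1 \<alpha> \<beta> \<gamma> z
          + N\<^sub>2 \<alpha> \<beta> \<gamma> z * Gauss_2F1 (\<alpha> + 1) (\<beta> + 1) (\<gamma> + 1) z)"
    apply (rule exI[of _ "\<lambda>\<alpha> \<beta> \<gamma> z. 1"], rule exI[of _ "\<lambda>\<alpha> \<beta> \<gamma> z. 0"], rule exI[of _ "\<lambda>\<alpha> \<beta> \<gamma> z. 1"])
    by (auto intro: one poly4_fun_const)
qed

lemma contiguous_pair_step:
  assumes "contiguous_pair i j k"
  shows "contiguous_pair (Suc i) j k" "contiguous_pair i (Suc j) k" "contiguous_pair i j (Suc k)"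
proof -
  define I J K :: complex where "I = of_nat i" and "J = of_nat j" and "K = of_nat k"
  note IJK = I_def[symmetric] J_def[symmetric] K_def[symmetric]
  have G: "contiguous_span (\<lambda>\<alpha> \<beta> \<gamma>. Gauss_2F1 (\<alpha> + I) (\<beta> + J) (\<gamma> + K))"
      "contiguous_span (\<lambda>\<alpha> \<beta> \<gamma>. Gauss_2F1 (\<alpha> + I + 1) (\<beta> + J + 1) (\<gamma> + K + 1))"
    using assms unfolding contiguous_pair_def IJK by auto
  have K: "\<gamma> + K \<notin> \<int>\<^sub>\<le>\<^sub>0" "\<gamma> + K + 1 \<notin> \<int>\<^sub>\<le>\<^sub>0" if "\<gamma> \<notin> \<int>\<^sub>\<le>\<^sub>0" for \<gamma>
    using not_nonpos_Int_add_of_nat[OF that, of k] not_nonpos_Int_add_of_nat[OF that, of "Suc k"]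
    by (simp_all add: K_def add_ac)
  \<comment> \<open>The second member of each new pair is a shift of the neighbour, so the neighbour
    of the neighbour is needed; the differential equation supplies it.\<close>
  have G2: "contiguous_span (\<lambda>\<alpha> \<beta> \<gamma>. Gauss_2F1 (\<alpha> + I + 2) (\<beta> + J + 2) (\<gamma> + K + 2))"
  proof (rule contiguous_span_comb[OF G(1) G(2)])
    show "allowed_denom (\<lambda>\<alpha> \<beta> \<gamma> z. z * (1 - z) * (\<alpha> + (I + 1)) * (\<beta> + (J + 1)))"
      by (intro allowed_denom_mult allowed_denom_linear)
    show "poly4_fun (\<lambda>\<alpha> \<beta> \<gamma> z. z * (1 - z) * (\<alpha> + (I + 1)) * (\<beta> + (J + 1)))"
      by (intro poly4_intros)
    show "poly4_fun (\<lambda>\<alpha> \<beta> \<gamma> z. (\<gamma> + K) * (\<gamma> + K + 1))"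
      by (intro poly4_intros)
    show "poly4_fun (\<lambda>\<alpha> \<beta> \<gamma> z. 0 - (\<gamma> + K + 1) * ((\<gamma> + K) - ((\<alpha> + I) + (\<beta> + J) + 1) * z))"
      by (intro poly4_intros)
    fix \<alpha> \<beta> \<gamma> z :: complex
    assume "norm z < 1" "\<gamma> \<notin> \<int>\<^sub>\<le>\<^sub>0"
    from Gauss_2F1_contiguous_diagonal[OF this(1) K(1)[OF this(2)], of "\<alpha> + I" "\<beta> + J"]
    show "z * (1 - z) * (\<alpha> + (I + 1)) * (\<beta> + (J + 1)) * Gauss_2F1 (\<alpha> + I + 2) (\<beta> + J + 2) (\<gamma> + K + 2) z
       = (\<gamma> + K) * (\<gamma> + K + 1) * Gauss_2F1 (\<alpha> + I) (\<beta> + J) (\<gamma> + K) z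
       + (0 - (\<gamma> + K + 1) * ((\<gamma> + K) - ((\<alpha> + I) + (\<beta> + J) + 1) * z))
           * Gauss_2F1 (\<alpha> + I + 1) (\<beta> + J + 1) (\<gamma> + K + 1) z"
      by algebra
  qed
  have two: "u + 1 + 1 = u + 2" for u :: complex by simp
  have "contiguous_span (\<lambda>\<alpha> \<beta> \<gamma>. Gauss_2F1 (\<alpha> + I + 1) (\<beta> + J) (\<gamma> + K))"
  proof (rule contiguous_span_comb[OF G(1) G(2)])
    show "allowed_denom (\<lambda>\<alpha> \<beta> \<gamma> z. \<gamma> + K)" by (rule allowed_denom_linear)
    show "poly4_fun (\<lambda>\<alpha> \<beta> \<gamma> z. \<gamma> + K)" "poly4_fun (\<lambda>\<alpha> \<beta> \<gamma> z. \<gamma> + K)"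
         "poly4_fun (\<lambda>\<alpha> \<beta> \<gamma> z. (\<beta> + J) * z)"
      by (intro poly4_intros)+
  qed (use K in \<open>auto intro!: Gauss_2F1_contiguous_upper\<close>)
  moreover have "contiguous_span (\<lambda>\<alpha> \<beta> \<gamma>. Gauss_2F1 (\<alpha> + I + 2) (\<beta> + J + 1) (\<gamma> + K + 1))"
  proof (rule contiguous_span_comb[OF G(2) G2])
    show "allowed_denom (\<lambda>\<alpha> \<beta> \<gamma> z. \<gamma> + (K + 1))" by (rule allowed_denom_linear)
    show "poly4_fun (\<lambda>\<alpha> \<beta> \<gamma> z. \<gamma> + (K + 1))" "poly4_fun (\<lambda>\<alpha> \<beta> \<gamma> z. \<gamma> + (K + 1))"
         "poly4_fun (\<lambda>\<alpha> \<beta> \<gamma> z. (\<beta> + J + 1) * z)"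
      by (intro poly4_intros)+
    fix \<alpha> \<beta> \<gamma> z :: complex
    assume "norm z < 1" "\<gamma> \<notin> \<int>\<^sub>\<le>\<^sub>0"
    from Gauss_2F1_contiguous_upper[OF this(1) K(2)[OF this(2)], of "\<alpha> + I + 1" "\<beta> + J + 1"]
    show "(\<gamma> + (K + 1)) * Gauss_2F1 (\<alpha> + I + 2) (\<beta> + J + 1) (\<gamma> + K + 1) z
       = (\<gamma> + (K + 1)) * Gauss_2F1 (\<alpha> + I + 1) (\<beta> + J + 1) (\<gamma> + K + 1) z
       + (\<beta> + J + 1) * z * Gauss_2F1 (\<alpha> + I + 2) (\<beta> + J + 2) (\<gamma> + K + 2) z"
      unfolding two by (simp add: add.assoc)
  qed
  ultimately show "contiguous_pair (Suc i) j k"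
    unfolding contiguous_pair_def I_def J_def K_def by (simp add: add_ac)
  have "contiguous_span (\<lambda>\<alpha> \<beta> \<gamma>. Gauss_2F1 (\<alpha> + I) (\<beta> + J + 1) (\<gamma> + K))"
  proof (rule contiguous_span_comb[OF G(1) G(2)])
    show "allowed_denom (\<lambda>\<alpha> \<beta> \<gamma> z. \<gamma> + K)" by (rule allowed_denom_linear)
    show "poly4_fun (\<lambda>\<alpha> \<beta> \<gamma> z. \<gamma> + K)" "poly4_fun (\<lambda>\<alpha> \<beta> \<gamma> z. \<gamma> + K)"
         "poly4_fun (\<lambda>\<alpha> \<beta> \<gamma> z. (\<alpha> + I) * z)"
      by (intro poly4_intros)+
    fix \<alpha> \<beta> \<gamma> z :: complex
    assume "norm z < 1" "\<gamma> \<notin> \<int>\<^sub>\<le>\<^sub>0"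
    from Gauss_2F1_contiguous_upper[OF this(1) K(1)[OF this(2)], of "\<beta> + J" "\<alpha> + I"]
    show "(\<gamma> + K) * Gauss_2F1 (\<alpha> + I) (\<beta> + J + 1) (\<gamma> + K) z
       = (\<gamma> + K) * Gauss_2F1 (\<alpha> + I) (\<beta> + J) (\<gamma> + K) z
       + (\<alpha> + I) * z * Gauss_2F1 (\<alpha> + I + 1) (\<beta> + J + 1) (\<gamma> + K + 1) z"
      unfolding Gauss_2F1_commute[of "\<beta> + J" for \<beta>] Gauss_2F1_commute[of "\<beta> + J + 1" for \<beta>] .
  qed
  moreover have "contiguous_span (\<lambda>\<alpha> \<beta> \<gamma>. Gauss_2F1 (\<alpha> + I + 1) (\<beta> + J + 2) (\<gamma> + K + 1))"
  proof (rule contiguous_span_comb[OF G(2) G2])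
    show "allowed_denom (\<lambda>\<alpha> \<beta> \<gamma> z. \<gamma> + (K + 1))" by (rule allowed_denom_linear)
    show "poly4_fun (\<lambda>\<alpha> \<beta> \<gamma> z. \<gamma> + (K + 1))" "poly4_fun (\<lambda>\<alpha> \<beta> \<gamma> z. \<gamma> + (K + 1))"
         "poly4_fun (\<lambda>\<alpha> \<beta> \<gamma> z. (\<alpha> + I + 1) * z)"
      by (intro poly4_intros)+
    fix \<alpha> \<beta> \<gamma> z :: complex
    assume "norm z < 1" "\<gamma> \<notin> \<int>\<^sub>\<le>\<^sub>0"
    from Gauss_2F1_contiguous_upper[OF this(1) K(2)[OF this(2)], of "\<beta> + J + 1" "\<alpha> + I + 1"]
    show "(\<gamma> + (K + 1)) * Gauss_2F1 (\<alpha> + I + 1) (\<beta> + J + 2) (\<gamma> + K + 1) z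
       = (\<gamma> + (K + 1)) * Gauss_2F1 (\<alpha> + I + 1) (\<beta> + J + 1) (\<gamma> + K + 1) z
       + (\<alpha> + I + 1) * z * Gauss_2F1 (\<alpha> + I + 2) (\<beta> + J + 2) (\<gamma> + K + 2) z"
      unfolding two Gauss_2F1_commute[of "\<beta> + J + 1" for \<beta>] Gauss_2F1_commute[of "\<beta> + J + 2" for \<beta>]
      by (simp add: add.assoc)
  qed
  ultimately show "contiguous_pair i (Suc j) k"
    unfolding contiguous_pair_def I_def J_def K_def by (simp add: add_ac)
  \<comment> \<open>The differences of lower and upper parameters do not change under a diagonal
    shift, so the same factor serves both members of the pair.\<close>
  have E: "allowed_denom (\<lambda>\<alpha> \<beta> \<gamma> z. (\<gamma> - \<alpha> + (K - I)) * (\<gamma> - \<beta> + (K - J)))"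
      "poly4_fun (\<lambda>\<alpha> \<beta> \<gamma> z. (\<gamma> - \<alpha> + (K - I)) * (\<gamma> - \<beta> + (K - J)))"
    by (intro allowed_denom_mult allowed_denom_linear poly4_intros)+
  have "contiguous_span (\<lambda>\<alpha> \<beta> \<gamma>. Gauss_2F1 (\<alpha> + I) (\<beta> + J) (\<gamma> + K + 1))"
  proof (rule contiguous_span_comb[OF G(1) G(2) E(2) _ _ E(1)])
    show "poly4_fun (\<lambda>\<alpha> \<beta> \<gamma> z. (\<gamma> + K) * ((\<gamma> + K) - (\<alpha> + I) - (\<beta> + J)))"
         "poly4_fun (\<lambda>\<alpha> \<beta> \<gamma> z. (\<alpha> + I) * (\<beta> + J) * (1 - z))"
      by (intro poly4_intros)+
    fix \<alpha> \<beta> \<gamma> z :: complex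
    assume "norm z < 1" "\<gamma> \<notin> \<int>\<^sub>\<le>\<^sub>0"
    from Gauss_2F1_contiguous_lower[OF this(1) K(1)[OF this(2)], of "\<alpha> + I" "\<beta> + J"]
    show "(\<gamma> - \<alpha> + (K - I)) * (\<gamma> - \<beta> + (K - J)) * Gauss_2F1 (\<alpha> + I) (\<beta> + J) (\<gamma> + K + 1) z
       = (\<gamma> + K) * ((\<gamma> + K) - (\<alpha> + I) - (\<beta> + J)) * Gauss_2F1 (\<alpha> + I) (\<beta> + J) (\<gamma> + K) z
       + (\<alpha> + I) * (\<beta> + J) * (1 - z) * Gauss_2F1 (\<alpha> + I + 1) (\<beta> + J + 1) (\<gamma> + K + 1) z"
      by algebra
  qed
  moreover have "contiguous_span (\<lambda>\<alpha> \<beta> \<gamma>. Gauss_2F1 (\<alpha> + I + 1) (\<beta> + J + 1) (\<gamma> + K + 2))"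
  proof (rule contiguous_span_comb[OF G(2) G2 E(2) _ _ E(1)])
    show "poly4_fun (\<lambda>\<alpha> \<beta> \<gamma> z. (\<gamma> + K + 1) * ((\<gamma> + K + 1) - (\<alpha> + I + 1) - (\<beta> + J + 1)))"
         "poly4_fun (\<lambda>\<alpha> \<beta> \<gamma> z. (\<alpha> + I + 1) * (\<beta> + J + 1) * (1 - z))"
      by (intro poly4_intros)+
    fix \<alpha> \<beta> \<gamma> z :: complex
    assume "norm z < 1" "\<gamma> \<notin> \<int>\<^sub>\<le>\<^sub>0"
    from Gauss_2F1_contiguous_lower[OF this(1) K(2)[OF this(2)], of "\<alpha> + I + 1" "\<beta> + J + 1"]
    show "(\<gamma> - \<alpha> + (K - I)) * (\<gamma> - \<beta> + (K - J)) * Gauss_2F1 (\<alpha> + I + 1) (\<beta> + J + 1) (\<gamma> + K + 2) z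
       = (\<gamma> + K + 1) * ((\<gamma> + K + 1) - (\<alpha> + I + 1) - (\<beta> + J + 1)) * Gauss_2F1 (\<alpha> + I + 1) (\<beta> + J + 1) (\<gamma> + K + 1) z
       + (\<alpha> + I + 1) * (\<beta> + J + 1) * (1 - z) * Gauss_2F1 (\<alpha> + I + 2) (\<beta> + J + 2) (\<gamma> + K + 2) z"
      unfolding two by algebra
  qed
  ultimately show "contiguous_pair i j (Suc k)"
    unfolding contiguous_pair_def I_def J_def K_def by (simp add: add_ac)
qed

lemma contiguous_pair_all: "contiguous_pair i j k"
proof -
  have "contiguous_pair i 0 0" by (induction i) (auto intro: contiguous_pair_0 contiguous_pair_step)
  then have "contiguous_pair i j 0" by (induction j) (auto intro: contiguous_pair_step)
  then show ?thesis by (induction k) (auto intro: contiguous_pair_step)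
qed

text \<open>One fraction with common denominator provides both coefficients. The multiplied-out
  identity is kept as a third conclusion, since it can be used along the line without asking whether
  \<open>D\<close> vanishes at the point.\<close>

lemma three_term_relation_exists:
  "\<exists>N\<^sub>R N\<^sub>Q D. three_term_relation (int i) (int j) (int k) N\<^sub>R D N\<^sub>Q D \<and>
     (\<forall>\<^sub>\<approx>w. eval4 D (p * w + a) (q * w + b) (r * w) x \<noteq> 0) \<and>
     (\<forall>\<alpha> \<beta> \<gamma> z. norm z < 1 \<longrightarrow> \<gamma> \<notin> \<int>\<^sub>\<le>\<^sub>0 \<longrightarrow>
        eval4 D \<alpha> \<beta> \<gamma> z * Gauss_2F1 (\<alpha> + of_nat i) (\<beta> + of_nat j) (\<gamma> + of_nat k) z =
          eval4 N\<^sub>R \<alpha> \<beta> \<gamma> z * Gauss_2F1 \<alpha> \<beta> \<gamma> z +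
          eval4 N\<^sub>Q \<alpha> \<beta> \<gamma> z * Gauss_2F1 (\<alpha> + 1) (\<beta> + 1) (\<gamma> + 1) z)"
proof -
  obtain D N\<^sub>R N\<^sub>Q where *: "allowed_denom (eval4 D)"
     "\<And>\<alpha> \<beta> \<gamma> z. norm z < 1 \<Longrightarrow> \<gamma> \<notin> \<int>\<^sub>\<le>\<^sub>0 \<Longrightarrow>
        eval4 D \<alpha> \<beta> \<gamma> z * Gauss_2F1 (\<alpha> + of_nat i) (\<beta> + of_nat j) (\<gamma> + of_nat k) z =
          eval4 N\<^sub>R \<alpha> \<beta> \<gamma> z * Gauss_2F1 \<alpha> \<beta> \<gamma> z +
          eval4 N\<^sub>Q \<alpha> \<beta> \<gamma> z * Gauss_2F1 (\<alpha> + 1) (\<beta> + 1) (\<gamma> + 1) z"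
    using contiguous_pair_all[of i j k] unfolding contiguous_pair_def contiguous_span_def poly4_fun_def
    by (auto simp flip: fun_eq_iff)
  have nz: "\<forall>\<^sub>\<approx>w. eval4 D (p * w + a) (q * w + b) (r * w) x \<noteq> 0"
    using *(1) by (simp add: allowed_denom_def)
  have "D \<noteq> 0"
  proof
    assume "D = 0"
    then have "\<forall>\<^sub>\<approx>w :: complex. False" using nz by (simp add: eval4_def)
    then show False by (simp add: eventually_False)
  qed
  then have "three_term_relation (int i) (int j) (int k) N\<^sub>R D N\<^sub>Q D"
    unfolding three_term_relation_def using *(2) by (auto simp: field_simps)
  then show ?thesis using nz *(2) by (intro exI conjI allI impI)
qed

end

section \<open>Positivity\<close>

text \<open>
  The numbers \<open>(b)\<^sub>n / (c)\<^sub>n\<close> are the moments of a beta distribution on the unit interval.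
\<close>

lemma beta_moments_nonneg:
  fixes f :: "nat \<Rightarrow> real" and b c s :: real
  assumes bc: "0 < b" "b < c"
    and summ: "summable (\<lambda>n. \<bar>f n\<bar>)"
    and nonneg: "\<And>t. 0 \<le> t \<Longrightarrow> t \<le> 1 \<Longrightarrow> 0 \<le> (\<Sum>n. f n * t ^ n)"
    and sums: "(\<lambda>n. f n * (pochhammer b n / pochhammer c n)) sums s"
  shows "0 \<le> s"
proof -
  define w where "w t = t powr (b - 1) * (1 - t) powr (c - b - 1)" for t :: real
  define B where "B = Beta b (c - b)"
  have B: "B > 0"
    using bc by (simp add: B_def Beta_def)
  have moment: "((\<lambda>t. t ^ n * w t) has_integral B * (pochhammer b n / pochhammer c n)) {0..1}" for n
  proof -
    \<comment> \<open>At \<open>t = 0\<close> both sides are 0 even for \<open>n = 0\<close>,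
      because \<open>0 powr y = 0\<close> for every \<open>y\<close>.\<close>
    have eq: "t ^ n * w t = t powr (b + real n - 1) * (1 - t) powr (c - b - 1)" if "t \<in> {0..1}" for t
    proof (cases "t = 0")
      case False
      then have "t > 0" using that by simp
      then show ?thesis
        by (auto simp: w_def powr_add powr_diff powr_realpow field_simps)
    qed (simp add: w_def)
    have nz: "b \<notin> \<int>\<^sub>\<le>\<^sub>0" "c \<notin> \<int>\<^sub>\<le>\<^sub>0" "c + real n \<notin> \<int>\<^sub>\<le>\<^sub>0" using bc by auto
    have "Gamma b \<noteq> 0" "Gamma c \<noteq> 0" "Gamma (c + real n) \<noteq> 0" "b + real n + (c - b) = c + real n"
      using nz by (auto simp: Gamma_eq_zero_iff)
    then have "Beta (b + real n) (c - b) = B * (pochhammer b n / pochhammer c n)"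
      unfolding Beta_def B_def pochhammer_Gamma[OF nz(1)] pochhammer_Gamma[OF nz(2)]
      by (simp add: divide_simps add.commute)
    then show ?thesis
      using has_integral_Beta_real[of "b + real n" "c - b"] bc
      by (intro has_integral_eq[OF eq[symmetric]]) simp_all
  qed
  \<comment> \<open>The tail bound makes each partial sum plus \<open>\<epsilon> N\<close>
    nonnegative on the unit interval, so only finite sums have to be integrated;
    \<open>\<epsilon> N\<close> disappears in the limit.\<close>
  define \<epsilon> where "\<epsilon> N = (\<Sum>i. \<bar>f (i + N)\<bar>)" for N
  have partial: "(\<Sum>n<N. f n * (pochhammer b n / pochhammer c n)) + \<epsilon> N \<ge> 0" for N
  proof -
    have "((\<lambda>t. (\<Sum>n<N. f n * (t ^ n * w t)) + \<epsilon> N * (t ^ 0 * w t)) has_integral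
            (\<Sum>n<N. f n * (B * (pochhammer b n / pochhammer c n))) + \<epsilon> N * (B * (pochhammer b 0 / pochhammer c 0))) {0..1}"
      by (rule has_integral_add[OF has_integral_sum[OF _ has_integral_mult_right[OF moment]]
              has_integral_mult_right[OF moment]]) simp
    moreover have "(\<Sum>n<N. f n * (t ^ n * w t)) + \<epsilon> N * (t ^ 0 * w t) \<ge> 0" if t: "t \<in> {0..1}" for t
    proof -
      have le: "\<bar>f n * t ^ n\<bar> \<le> \<bar>f n\<bar>" for n
        using t by (simp add: abs_mult power_le_one mult_left_le)
      have st: "summable (\<lambda>n. \<bar>f n * t ^ n\<bar>)"
        by (rule summable_comparison_test'[OF summ, of 0]) (use le in simp)
      then have st': "summable (\<lambda>n. f n * t ^ n)" by (rule summable_rabs_cancel)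
      have "(\<Sum>i. f (i + N) * t ^ (i + N)) \<le> \<epsilon> N"
        unfolding \<epsilon>_def
      proof (rule suminf_le)
        show "f (i + N) * t ^ (i + N) \<le> \<bar>f (i + N)\<bar>" for i
          using le[of "i + N"] by linarith
        show "summable (\<lambda>i. f (i + N) * t ^ (i + N))"
          using summable_ignore_initial_segment[OF st', of N] .
        show "summable (\<lambda>i. \<bar>f (i + N)\<bar>)"
          using summable_ignore_initial_segment[OF summ, of N] .
      qed
      moreover have "(\<Sum>n. f n * t ^ n) = (\<Sum>i. f (i + N) * t ^ (i + N)) + (\<Sum>n<N. f n * t ^ n)"
        by (rule suminf_split_initial_segment[OF st'])
      ultimately have "(\<Sum>n<N. f n * t ^ n) + \<epsilon> N \<ge> 0"
        using nonneg[of t] t by simp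
      moreover have "w t \<ge> 0" by (simp add: w_def)
      ultimately have "((\<Sum>n<N. f n * t ^ n) + \<epsilon> N) * w t \<ge> 0" by simp
      then show ?thesis
        by (simp add: distrib_right sum_distrib_right mult.assoc)
    qed
    ultimately have "(\<Sum>n<N. f n * (B * (pochhammer b n / pochhammer c n))) + \<epsilon> N * (B * (pochhammer b 0 / pochhammer c 0)) \<ge> 0"
      by (rule has_integral_nonneg)
    then have "B * ((\<Sum>n<N. f n * (pochhammer b n / pochhammer c n)) + \<epsilon> N) \<ge> 0"
      by (simp add: distrib_left sum_distrib_left mult_ac)
    then show ?thesis
      using B by (simp add: zero_le_mult_iff)
  qed
  have "\<epsilon> \<longlonglongrightarrow> 0"
    unfolding \<epsilon>_def by (rule suminf_exist_split2[OF summ])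
  then have "(\<lambda>N. (\<Sum>n<N. f n * (pochhammer b n / pochhammer c n)) + \<epsilon> N) \<longlonglongrightarrow> s + 0"
    using sums unfolding sums_def by (intro tendsto_add)
  then show ?thesis
    using LIMSEQ_le_const[of _ s 0] partial by auto
qed

lemma Gauss_2F1_of_real_sums:
  fixes \<alpha> \<beta> \<gamma> x :: real
  assumes "\<bar>x\<bar> < 1"
  defines "t \<equiv> \<lambda>n. pochhammer \<alpha> n * pochhammer \<beta> n / (pochhammer \<gamma> n * fact n) * x ^ n"
  shows "summable (\<lambda>n. \<bar>t n\<bar>)" "t sums suminf t"
    and "Gauss_2F1 (of_real \<alpha>) (of_real \<beta>) (of_real \<gamma>) (of_real x) = of_real (suminf t)"
proof -
  have eq: "fps_nth (fps_2F1 (of_real \<alpha>) (of_real \<beta>) (of_real \<gamma>)) n * of_real x ^ n = of_real (t n)" for n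
    unfolding fps_2F1_nth t_def pochhammer_of_real by simp
  show "summable (\<lambda>n. \<bar>t n\<bar>)"
    using summable_2F1[of "of_real x" "of_real \<alpha>" "of_real \<beta>" "of_real \<gamma>"] assms(1)
    unfolding eq norm_of_real by simp
  then show *: "t sums suminf t"
    by (rule summable_sums[OF summable_rabs_cancel])
  show "Gauss_2F1 (of_real \<alpha>) (of_real \<beta>) (of_real \<gamma>) (of_real x) = of_real (suminf t)"
    unfolding Gauss_2F1_def eval_fps_def eq using sums_unique[OF sums_of_real[OF *, where 'a = complex]] by simp
qed

lemma binomial_series_neg_powr:
  fixes \<alpha> y :: real
  assumes "\<bar>y\<bar> < 1"
  shows "(\<lambda>n. pochhammer \<alpha> n / fact n * y ^ n) sums ((1 - y) powr (- \<alpha>))"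
proof -
  have eq: "((- \<alpha>) gchoose n) * (- y) ^ n = pochhammer \<alpha> n / fact n * y ^ n" for n
  proof -
    have "((-1) ^ n * (-1) ^ n :: real) = 1"
      by (simp flip: power_mult_distrib)
    then show ?thesis
      by (simp add: gbinomial_pochhammer power_minus[of y])
  qed
  show ?thesis
    using gen_binomial_real[of "- y" "- \<alpha>"] assms unfolding eq by simp
qed

text \<open>By Euler's integral the value is the mean of
  \<open>(1 - x * u) powr (- \<alpha>)\<close> over a beta distribution of \<open>u\<close>.
  Subtracting a positive lower bound of this function turns the nonnegativity of
  \<open>beta_moments_nonneg\<close> into strict positivity.\<close>

lemma Gauss_2F1_pos:
  fixes \<alpha> \<beta> \<gamma> x :: real
  assumes "\<bar>x\<bar> < 1" "0 < \<alpha>" "0 < \<beta>" "\<beta> < \<gamma>"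
  obtains y where "Gauss_2F1 (of_real \<alpha>) (of_real \<beta>) (of_real \<gamma>) (of_real x) = of_real y" "0 < y"
proof -
  define t where "t = (\<lambda>n. pochhammer \<alpha> n * pochhammer \<beta> n / (pochhammer \<gamma> n * fact n) * x ^ n)"
  \<comment> \<open>A lower bound for \<open>(1 - x * u) powr (- \<alpha>)\<close>, since
    \<open>1 - x * u < 2\<close> and the exponent is negative. It is subtracted from the term of
    index 0, whose moment is 1.\<close>
  define m :: real where "m = 2 powr (- \<alpha>)"
  define f where "f n = pochhammer \<alpha> n / fact n * x ^ n - (if n = 0 then m else 0)" for n
  have delta: "(\<lambda>n. if n = 0 then m else 0) sums m"
    using sums_single[of 0 "\<lambda>_. m"] by simp
  have "0 \<le> suminf t - m"
  proof (rule beta_moments_nonneg[OF assms(3,4)])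
    \<comment> \<open>The binomial series is the hypergeometric series with \<beta> and \<gamma>
      equal to 1.\<close>
    have "summable (\<lambda>n. \<bar>pochhammer \<alpha> n / fact n * x ^ n\<bar>)"
      using Gauss_2F1_of_real_sums(1)[OF assms(1), of \<alpha> 1 1]
      by (simp add: pochhammer_fact[symmetric])
    moreover have "summable (\<lambda>n. \<bar>if n = 0 then m else 0 :: real\<bar>)"
      by (rule summable_finite[of "{0}"]) auto
    ultimately have "summable (\<lambda>n. \<bar>pochhammer \<alpha> n / fact n * x ^ n\<bar> + \<bar>if n = 0 then m else 0\<bar>)"
      by (rule summable_add)
    then show "summable (\<lambda>n. \<bar>f n\<bar>)"
      by (rule summable_comparison_test'[where N = 0]) (use abs_triangle_ineq4 in \<open>auto simp: f_def\<close>)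
    show "0 \<le> (\<Sum>n. f n * u ^ n)" if u: "0 \<le> u" "u \<le> 1" for u
    proof -
      have xu: "\<bar>x * u\<bar> < 1"
        using assms(1) u mult_left_le[of u "\<bar>x\<bar>"] by (simp add: abs_mult)
      have "(\<lambda>n. pochhammer \<alpha> n / fact n * (x * u) ^ n - (if n = 0 then m else 0)) sums
              ((1 - x * u) powr (- \<alpha>) - m)"
        by (intro sums_diff binomial_series_neg_powr xu delta)
      also have "(\<lambda>n. pochhammer \<alpha> n / fact n * (x * u) ^ n - (if n = 0 then m else 0)) = (\<lambda>n. f n * u ^ n)"
        by (auto simp: fun_eq_iff f_def power_mult_distrib)
      finally have "(\<Sum>n. f n * u ^ n) = (1 - x * u) powr (- \<alpha>) - m"
        by (simp add: sums_iff)
      moreover have "m \<le> (1 - x * u) powr (- \<alpha>)"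
        unfolding m_def using xu assms(2) by (intro powr_mono2') auto
      ultimately show ?thesis by simp
    qed
    have "(\<lambda>n. t n - (if n = 0 then m else 0)) sums (suminf t - m)"
      using Gauss_2F1_of_real_sums(2)[OF assms(1), of \<alpha> \<beta> \<gamma>] delta unfolding t_def by (rule sums_diff)
    moreover have "(\<lambda>n. t n - (if n = 0 then m else 0)) = (\<lambda>n. f n * (pochhammer \<beta> n / pochhammer \<gamma> n))"
      by (auto simp: fun_eq_iff t_def f_def mult_ac)
    ultimately show "(\<lambda>n. f n * (pochhammer \<beta> n / pochhammer \<gamma> n)) sums (suminf t - m)"
      by simp
  qed
  then have "suminf t > 0"
    using powr_gt_zero[of 2 "- \<alpha>"] unfolding m_def by linarith
  then show thesis
    using that Gauss_2F1_of_real_sums(3)[OF assms(1), of \<alpha> \<beta> \<gamma>] unfolding t_def by blast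
qed

section \<open>Dependence on the parameters\<close>

text \<open>Olver's regularised hypergeometric function. At a nonpositive integer \<gamma>, where
  the ordinary series breaks down, finitely many of its initial terms vanish instead.\<close>

definition reg_2F1 :: "complex \<Rightarrow> complex \<Rightarrow> complex \<Rightarrow> complex \<Rightarrow> complex" where
  "reg_2F1 \<alpha> \<beta> \<gamma> z =
     (\<Sum>n. pochhammer \<alpha> n * pochhammer \<beta> n * rGamma (\<gamma> + of_nat n) / fact n * z ^ n)"

lemma reg_2F1_eq:
  assumes "norm z < 1" "\<gamma> \<notin> \<int>\<^sub>\<le>\<^sub>0"
  shows "reg_2F1 \<alpha> \<beta> \<gamma> z = rGamma \<gamma> * Gauss_2F1 \<alpha> \<beta> \<gamma> z"
proof -
  have "pochhammer \<alpha> n * pochhammer \<beta> n * rGamma (\<gamma> + of_nat n) / fact n * z ^ n =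
        rGamma \<gamma> * (fps_nth (fps_2F1 \<alpha> \<beta> \<gamma>) n * z ^ n)" for n
    unfolding fps_2F1_nth pochhammer_rGamma[of \<gamma> n]
    using pochhammer_nonzero[OF assms(2), of n] by (simp add: field_simps)
  then show ?thesis
    unfolding reg_2F1_def Gauss_2F1_def eval_fps_def
    using suminf_mult[OF summable_norm_cancel[OF summable_2F1[OF assms(1), of \<alpha> \<beta> \<gamma>]], of "rGamma \<gamma>"] by simp
qed

text \<open>The terms with \<open>n < N\<close> vanish, as \<open>rGamma\<close> is 0 at nonpositive
  integers; reindexing the rest gives an ordinary series. Writing the parameter as
  \<open>1 - of_nat N\<close> makes \<open>N\<close> the index of the first term left, including
  \<open>N = 0\<close>.\<close>

lemma reg_2F1_nonpos:
  assumes "norm z < 1"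
  shows "reg_2F1 \<alpha> \<beta> (1 - of_nat N) z = pochhammer \<alpha> N * pochhammer \<beta> N / fact N * z ^ N *
           Gauss_2F1 (\<alpha> + of_nat N) (\<beta> + of_nat N) (of_nat N + 1) z"
proof -
  define t where "t n = pochhammer \<alpha> n * pochhammer \<beta> n * rGamma (1 - of_nat N + of_nat n) / fact n * z ^ n" for n
  let ?C = "pochhammer \<alpha> N * pochhammer \<beta> N / fact N * z ^ N"
  define u where "u m = fps_nth (fps_2F1 (\<alpha> + of_nat N) (\<beta> + of_nat N) (of_nat N + 1)) m * z ^ m" for m
  have su: "summable u"
    unfolding u_def by (rule summable_norm_cancel[OF summable_2F1[OF assms]])
  have t0: "t n = 0" if "n < N" for n
  proof -
    obtain d where "N = n + Suc d"
      using \<open>n < N\<close> less_imp_Suc_add by fastforce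
    then have "1 - of_nat N + of_nat n = - (of_nat d :: complex)"
      by simp
    then have "rGamma (1 - of_nat N + of_nat n :: complex) = 0"
      by (simp only: rGamma_eq_zero_iff minus_of_nat_in_nonpos_Ints)
    then show ?thesis by (simp add: t_def)
  qed
  have t1: "t (m + N) = ?C * u m" for m
  proof -
    have "rGamma (1 - of_nat N + of_nat (m + N) :: complex) = 1 / fact m"
      using rGamma_of_int[of "int m + 1", where 'a = complex] by (simp add: add.commute divide_inverse)
    moreover have "fact (m + N) = fact N * pochhammer (of_nat N + 1 :: complex) m"
      using pochhammer_product'[of "1 :: complex" N m]
      by (simp add: pochhammer_fact[symmetric] add.commute)
    ultimately show ?thesis
      using pochhammer_product'[of \<alpha> N m] pochhammer_product'[of \<beta> N m]
      unfolding t_def u_def fps_2F1_nth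
      by (simp add: add.commute[of m N] power_add mult_ac)
  qed
  have "summable (\<lambda>m. t (m + N))"
    unfolding t1 by (rule summable_mult[OF su])
  then have "summable t"
    by (simp add: summable_iff_shift)
  then have "suminf t = (\<Sum>m. t (m + N)) + (\<Sum>n<N. t n)"
    by (rule suminf_split_initial_segment)
  also have "\<dots> = ?C * suminf u"
    unfolding t1 suminf_mult[OF su] using t0 by simp
  finally show ?thesis
    unfolding reg_2F1_def t_def u_def Gauss_2F1_def eval_fps_def .
qed

text \<open>Each term is entire in \<open>w\<close>, and the M-test with a geometric majorant gives
  uniform convergence on discs of radius 1. The constants \<open>c = 0\<close> and
  \<open>c = 1\<close> serve \<open>F\<close> and \<open>G\<close>.\<close>

lemma reg_2F1_line_holomorphic:
  assumes x: "norm x < 1"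
  shows "(\<lambda>w. reg_2F1 (p * w + a) (q * w + b) (r * w + c) x) holomorphic_on UNIV"
proof -
  define t where "t n w = pochhammer (p * w + a) n * pochhammer (q * w + b) n *
      rGamma (r * w + c + of_nat n) / fact n * x ^ n" for n w
  have hol: "t n holomorphic_on A" for n A
    unfolding t_def pochhammer_prod by (intro holomorphic_intros) auto
  define \<rho> where "\<rho> = (norm x + 1) / 2"
  have \<rho>: "norm x < \<rho>" "\<rho> < 1" "\<rho> \<ge> 0" using x norm_ge_zero[of x] by (auto simp: \<rho>_def)
  have bdd: "\<exists>K. \<forall>w\<in>cball w0 1. norm (h w) \<le> K" if "continuous_on UNIV h" for h :: "complex \<Rightarrow> complex" and w0
  proof -
    have "compact (h ` cball w0 1)"
      by (intro compact_continuous_image continuous_on_subset[OF that]) auto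
    then show ?thesis
      using compact_imp_bounded[of "h ` cball w0 1"] unfolding bounded_iff by auto
  qed
  have unif: "uniform_limit (cball w0 1) (\<lambda>n w. \<Sum>i<n. t i w) (\<lambda>w. \<Sum>n. t n w) sequentially" for w0
  proof -
    obtain K1 K2 K3 where K: "\<forall>w\<in>cball w0 1. norm (p * w + a) \<le> K1" "\<forall>w\<in>cball w0 1. norm (q * w + b) \<le> K2"
        "\<forall>w\<in>cball w0 1. norm (r * w + c) \<le> K3"
      using bdd[of "\<lambda>w. p * w + a" w0] bdd[of "\<lambda>w. q * w + b" w0] bdd[of "\<lambda>w. r * w + c" w0]
      by (force intro: continuous_intros)
    define R where "R = max K1 (max K2 K3)"
    have R: "norm (p * w + a) \<le> R" "norm (q * w + b) \<le> R" "norm (r * w + c) \<le> R" if "w \<in> cball w0 1" for w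
      using K that unfolding R_def by (auto simp: le_max_iff_disj)
    obtain N where N: "\<And>n w. n \<ge> N \<Longrightarrow> w \<in> cball w0 1 \<Longrightarrow> r * w + c + of_nat n \<noteq> 0 \<and>
       norm ((p * w + a + of_nat n) * (q * w + b + of_nat n) / ((r * w + c + of_nat n) * of_nat (Suc n)) * x) \<le> \<rho>"
      using hypergeo_ratio_bound[OF \<rho>(1), of R] R unfolding eventually_sequentially by blast
    obtain M where M: "\<forall>w\<in>cball w0 1. norm (t N w) \<le> M"
      using bdd[OF holomorphic_on_imp_continuous_on[OF hol]] by blast
    have bound: "norm (t (N + m) w) \<le> M * \<rho> ^ m" if w: "w \<in> cball w0 1" for m w
    proof (induction m)
      case 0 then show ?case using M w by simp
    next
      case (Suc m)
      define n where "n = N + m"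
      have n: "r * w + c + of_nat n \<noteq> 0"
         "norm ((p * w + a + of_nat n) * (q * w + b + of_nat n) / ((r * w + c + of_nat n) * of_nat (Suc n)) * x) \<le> \<rho>"
        using N[of n w] w by (auto simp: n_def)
      \<comment> \<open>The term ratio is obtained by dividing by
        \<open>r * w + c + of_nat n\<close>, which is nonzero on the whole disc from index
        \<open>N\<close> on.\<close>
      have rG: "rGamma (r * w + c + of_nat n) = (r * w + c + of_nat n) * rGamma (r * w + c + of_nat (Suc n))"
        using rGamma_plus1[of "r * w + c + of_nat n"] by (simp add: add_ac)
      have frac: "(P * A) * (Q * B) * G / (s * f) * (x * y) = A * B / (C * s) * x * (P * Q * (C * G) / f * y)"
        if "C \<noteq> 0" "s \<noteq> 0" "f \<noteq> 0" for P Q A B C G s f y :: complex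
        using that by (simp add: field_simps)
      have "t (Suc n) w = (p * w + a + of_nat n) * (q * w + b + of_nat n) /
          ((r * w + c + of_nat n) * of_nat (Suc n)) * x * t n w"
        unfolding t_def pochhammer_Suc fact_Suc power_Suc rG
        by (rule frac[OF n(1) of_nat_neq_0 fact_nonzero])
      then have "norm (t (Suc n) w) = norm ((p * w + a + of_nat n) * (q * w + b + of_nat n) /
          ((r * w + c + of_nat n) * of_nat (Suc n)) * x) * norm (t n w)"
        by (simp only: norm_mult)
      also have "\<dots> \<le> \<rho> * (M * \<rho> ^ m)"
        using Suc n(2) \<rho>(3) by (intro mult_mono) (auto simp: n_def)
      finally show ?case by (simp add: n_def mult_ac)
    qed
    show ?thesis
    proof (rule Weierstrass_m_test_ev)
      show "\<forall>\<^sub>F n in sequentially. \<forall>w\<in>cball w0 1. norm (t n w) \<le> M * \<rho> ^ (n - N)"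
        using eventually_ge_at_top[of N]
      proof eventually_elim
        case (elim n)
        then show ?case using bound[of _ "n - N"] by simp
      qed
      have "summable (\<lambda>n. M * \<rho> ^ (n + N - N))"
        using \<rho> by (simp add: summable_mult summable_geometric)
      then show "summable (\<lambda>n. M * \<rho> ^ (n - N))"
        by (subst (asm) summable_iff_shift)
    qed
  qed
  have "(\<lambda>w. \<Sum>n. t n w) holomorphic_on UNIV"
  proof (rule holomorphic_uniform_sequence[OF open_UNIV])
    show "(\<lambda>w. \<Sum>i<n. t i w) holomorphic_on UNIV" for n
      by (intro holomorphic_intros hol)
    show "\<exists>d>0. cball w0 d \<subseteq> UNIV \<and> uniform_limit (cball w0 d) (\<lambda>n w. \<Sum>i<n. t i w) (\<lambda>w. \<Sum>n. t n w) sequentially" for w0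
      using unif[of w0] by (intro exI[of _ 1]) auto
  qed
  then show ?thesis
    by (simp add: reg_2F1_def t_def)
qed

section \<open>Poles of the hypergeometric function on the line\<close>

lemma cosparse_not_nonpos_Int:
  fixes r :: complex
  assumes "r \<noteq> 0"
  shows "\<forall>\<^sub>\<approx>w. r * w \<notin> \<int>\<^sub>\<le>\<^sub>0"
proof -
  have "{w. r * w \<in> \<int>\<^sub>\<le>\<^sub>0} = {w. rGamma (r * w) = 0}"
    by (simp add: rGamma_eq_zero_iff)
  moreover have "(\<forall>\<^sub>\<approx>w. rGamma (r * w) \<noteq> 0)"
  proof -
    show ?thesis
      unfolding eventually_cosparse_open_eq[OF open_UNIV]
    proof
      fix z :: complex
      define h where "h = (\<lambda>w. rGamma (r * w))"
      have hol: "h holomorphic_on UNIV" unfolding h_def by (intro holomorphic_intros)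
      show "\<forall>\<^sub>F w in at z. rGamma (r * w) \<noteq> 0"
      proof (cases "h z = 0")
        case True
        \<comment> \<open>Since \<open>rGamma 1 = 1\<close>, the entire function \<open>h\<close> is
          not identically zero, hence its zeros are isolated.\<close>
        have "h (1 / r) \<noteq> 0" using assms by (simp add: h_def)
        then show ?thesis
          using non_zero_neighbour_alt[of h UNIV z "1 / r"] hol by (auto simp: h_def elim!: eventually_mono)
      next
        case False
        then show ?thesis
          using non_zero_neighbour_alt[of h UNIV z z] hol by (auto simp: h_def elim!: eventually_mono)
      qed
    qed
  qed
  ultimately show ?thesis by (simp add: rGamma_eq_zero_iff)
qed

lemma hyp_f_eq:
  assumes "norm x < 1" "r * w \<notin> \<int>\<^sub>\<le>\<^sub>0"
  shows "hyp_f p q r a b x w = reg_2F1 (p * w + a) (q * w + b) (r * w) x / rGamma (r * w)"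
  using assms by (simp add: hyp_f_def reg_2F1_eq rGamma_eq_zero_iff)

text \<open>The function is a quotient of entire functions with denominator
  \<open>rGamma (r * w)\<close>, whose zeros are simple. A zero of the numerator there would cancel,
  and l'Hopital's rule would give a finite limit.\<close>

lemma is_pole_hyp_f:
  assumes x: "norm x < 1" and r: "r \<noteq> 0" and pole: "is_pole (hyp_f p q r a b x) w\<^sub>0"
  shows "r * w\<^sub>0 \<in> \<int>\<^sub>\<le>\<^sub>0" "reg_2F1 (p * w\<^sub>0 + a) (q * w\<^sub>0 + b) (r * w\<^sub>0) x \<noteq> 0"
proof -
  define \<Phi> where "\<Phi> w = reg_2F1 (p * w + a) (q * w + b) (r * w) x" for w
  have hol: "\<Phi> holomorphic_on UNIV"
    using reg_2F1_line_holomorphic[OF x, of p a q b r 0] unfolding \<Phi>_def by simp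
  have "\<forall>\<^sub>F w in at w\<^sub>0. r * w \<notin> \<int>\<^sub>\<le>\<^sub>0"
    using cosparse_not_nonpos_Int[OF r] by (simp add: eventually_cosparse_open_eq)
  then have ev: "\<forall>\<^sub>F w in at w\<^sub>0. hyp_f p q r a b x w = \<Phi> w / rGamma (r * w)"
    by eventually_elim (simp add: hyp_f_eq[OF x] \<Phi>_def)
  have no_limit: False if "((\<lambda>w. \<Phi> w / rGamma (r * w)) \<longlongrightarrow> l) (at w\<^sub>0)" for l
  proof -
    have "(hyp_f p q r a b x \<longlongrightarrow> l) (at w\<^sub>0)"
      using that by (subst tendsto_cong[OF ev])
    then show False
      using pole not_tendsto_and_filterlim_at_infinity[of "at w\<^sub>0" "hyp_f p q r a b x" l]
      unfolding is_pole_def by simp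
  qed
  have cont: "isCont \<Phi> w\<^sub>0"
    using holomorphic_on_imp_continuous_on[OF hol] by (simp add: continuous_on_eq_continuous_at)
  show int: "r * w\<^sub>0 \<in> \<int>\<^sub>\<le>\<^sub>0"
  proof (rule ccontr)
    assume "r * w\<^sub>0 \<notin> \<int>\<^sub>\<le>\<^sub>0"
    then have nz: "rGamma (r * w\<^sub>0) \<noteq> 0" by (simp add: rGamma_eq_zero_iff)
    have "isCont (\<lambda>w. rGamma (r * w)) w\<^sub>0" by (intro continuous_intros)
    with cont nz have "isCont (\<lambda>w. \<Phi> w / rGamma (r * w)) w\<^sub>0" by (intro continuous_intros)
    then show False using no_limit unfolding isCont_def by blast
  qed
  show "reg_2F1 (p * w\<^sub>0 + a) (q * w\<^sub>0 + b) (r * w\<^sub>0) x \<noteq> 0"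
  proof
    assume "reg_2F1 (p * w\<^sub>0 + a) (q * w\<^sub>0 + b) (r * w\<^sub>0) x = 0"
    then have \<Phi>0: "\<Phi> w\<^sub>0 = 0" by (simp add: \<Phi>_def)
    obtain \<Phi>' where d: "(\<Phi> has_field_derivative \<Phi>') (at w\<^sub>0)"
      using holomorphic_derivI[OF hol open_UNIV] by blast
    obtain k where k: "r * w\<^sub>0 = - of_nat k"
      using int by (elim nonpos_Ints_cases')
    have "(rGamma has_field_derivative (-1) ^ k * fact k) (at (r * w\<^sub>0))"
      unfolding k by (rule has_field_derivative_rGamma_nonpos_int)
    moreover have "((\<lambda>w. r * w) has_field_derivative r) (at w\<^sub>0)"
      by (auto intro!: derivative_eq_intros)
    ultimately have "((\<lambda>w. rGamma (r * w)) has_field_derivative ((-1) ^ k * fact k * r)) (at w\<^sub>0)"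
      by (rule DERIV_chain2)
    from lhopital_complex_simple[OF d this \<Phi>0]
    have "((\<lambda>w. \<Phi> w / rGamma (r * w)) \<longlongrightarrow> \<Phi>' / ((-1) ^ k * fact k * r)) (at w\<^sub>0)"
      using int r by (simp add: rGamma_eq_zero_iff)
    then show False by (rule no_limit)
  qed
qed

section \<open>The quotient of contiguous functions on the line\<close>

text \<open>The factor \<gamma> undoes the regularisation, because
  \<open>\<gamma> * rGamma (\<gamma> + 1) = rGamma \<gamma>\<close>; thus \<open>h\<close> is the
  quotient of the ordinary series. Its bound expresses that the third series in
  \<open>Gauss_2F1_contiguous_euler\<close> is positive.\<close>

lemma reg_2F1_quotient_right:
  fixes \<alpha> \<beta> \<gamma> x :: real
  assumes "\<bar>x\<bar> < 1" "0 < \<alpha>" "0 < \<beta>" "\<beta> < \<gamma>"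
  obtains h where "reg_2F1 (of_real \<alpha>) (of_real \<beta>) (of_real \<gamma>) (of_real x) \<noteq> 0"
    "of_real \<gamma> * reg_2F1 (of_real \<alpha> + 1) (of_real \<beta> + 1) (of_real \<gamma> + 1) (of_real x) =
       of_real h * reg_2F1 (of_real \<alpha>) (of_real \<beta>) (of_real \<gamma>) (of_real x)"
    "0 \<le> h" "h \<le> \<gamma> / ((1 - x) * \<beta>)"
proof -
  obtain y where y: "Gauss_2F1 (of_real \<alpha>) (of_real \<beta>) (of_real \<gamma>) (of_real x) = of_real y" "0 < y"
    using Gauss_2F1_pos[of x \<alpha> \<beta> \<gamma>] assms by auto
  obtain y' where y': "Gauss_2F1 (of_real \<alpha> + 1) (of_real \<beta> + 1) (of_real \<gamma> + 1) (of_real x) = of_real y'" "0 < y'"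
    using Gauss_2F1_pos[of x "\<alpha> + 1" "\<beta> + 1" "\<gamma> + 1"] assms by auto
  obtain y'' where y'': "Gauss_2F1 (of_real \<alpha> + 1) (of_real \<beta>) (of_real \<gamma> + 1) (of_real x) = of_real y''" "0 < y''"
    using Gauss_2F1_pos[of x "\<alpha> + 1" "\<beta>" "\<gamma> + 1"] assms by auto
  have x: "norm (of_real x :: complex) < 1" using assms by simp
  have "\<gamma> \<notin> \<int>\<^sub>\<le>\<^sub>0" "\<gamma> + 1 \<notin> \<int>\<^sub>\<le>\<^sub>0" using assms by auto
  then have \<gamma>: "(of_real \<gamma> :: complex) \<notin> \<int>\<^sub>\<le>\<^sub>0" "(of_real \<gamma> + 1 :: complex) \<notin> \<int>\<^sub>\<le>\<^sub>0"
    using of_real_in_nonpos_Ints_iff[of \<gamma>, where 'a = complex]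
      of_real_in_nonpos_Ints_iff[of "\<gamma> + 1", where 'a = complex] by simp_all
  have "complex_of_real (\<gamma> * y - (1 - x) * \<beta> * y') = of_real ((\<gamma> - \<beta>) * y'')"
    using Gauss_2F1_contiguous_euler[OF x \<gamma>(1), of "of_real \<alpha>" "of_real \<beta>"] unfolding y y' y'' by simp
  then have "\<gamma> * y - (1 - x) * \<beta> * y' = (\<gamma> - \<beta>) * y''"
    unfolding of_real_eq_iff .
  moreover have "(\<gamma> - \<beta>) * y'' \<ge> 0" using assms y'' by simp
  ultimately have "(1 - x) * \<beta> * y' \<le> \<gamma> * y" by linarith
  then have "y' / y \<le> \<gamma> / ((1 - x) * \<beta>)"
    using assms y(2) by (simp add: field_simps)
  moreover have "rGamma (of_real \<gamma>) \<noteq> (0 :: complex)"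
    using \<gamma>(1) by (simp add: rGamma_eq_zero_iff)
  moreover have "of_real \<gamma> * rGamma (of_real \<gamma> + 1 :: complex) = rGamma (of_real \<gamma>)"
    by (rule rGamma_plus1)
  ultimately show thesis
    using that[of "y' / y"] y y'
    by (simp add: reg_2F1_eq[OF x \<gamma>(1)] reg_2F1_eq[OF x \<gamma>(2)] flip: mult.assoc)
qed

text \<open>
  At \<open>\<gamma> = - j\<close> the regularised series for \<open>F\<close> and \<open>G\<close> start at the terms of index \<open>j + 1\<close> and \<open>j\<close>, so that
  both have the upper parameters \<open>\<alpha> + j + 1\<close> and \<open>\<beta> + j + 1\<close>.
\<close>

lemma reg_2F1_quotient_left:
  fixes \<alpha> \<beta> x :: real and j :: nat
  assumes x: "\<bar>x\<bar> < 1" "x \<noteq> 0" and \<alpha>: "\<alpha> < 0" "0 < \<alpha> + real j + 1" and \<beta>: "\<beta> < 0" "0 < \<beta> + real j + 1"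
  obtains h where
    "- of_nat j * reg_2F1 (of_real \<alpha> + 1) (of_real \<beta> + 1) (- of_nat j + 1) (of_real x) =
       of_real h * reg_2F1 (of_real \<alpha>) (of_real \<beta>) (- of_nat j) (of_real x)"
    "x * h \<le> real j / \<beta>"
proof -
  define A B where "A = \<alpha> + real j + 1" and "B = \<beta> + real j + 1"
  note AB = \<alpha>(2)[folded A_def] \<beta>(2)[folded B_def]
  have A: "A < real j + 1" using \<alpha> by (simp add: A_def)
  \<comment> \<open>Positivity asks only one upper parameter to be smaller than the lower one. Here
    this is \<open>A\<close> (or \<open>A + 1\<close>), hence the exchange of the upper
    parameters.\<close>
  obtain y\<^sub>1 where y1: "Gauss_2F1 (of_real A) (of_real B) (of_nat j + 1) (of_real x) = of_real y\<^sub>1" "0 < y\<^sub>1"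
    using Gauss_2F1_pos[of x B A "real j + 1"] x AB A Gauss_2F1_commute[of "of_real A"] by auto
  obtain y\<^sub>2 where y2: "Gauss_2F1 (of_real A) (of_real B) (of_nat j + 2) (of_real x) = of_real y\<^sub>2" "0 < y\<^sub>2"
    using Gauss_2F1_pos[of x B A "real j + 2"] x AB A Gauss_2F1_commute[of "of_real A"] by auto
  obtain y\<^sub>3 where y3: "Gauss_2F1 (of_real A + 1) (of_real B) (of_nat j + 2) (of_real x) = of_real y\<^sub>3" "0 < y\<^sub>3"
    using Gauss_2F1_pos[of x B "A + 1" "real j + 2"] x AB A Gauss_2F1_commute[of "of_real A + 1"] by auto
  have z: "norm (of_real x :: complex) < 1" using x by simp
  have j1: "(of_nat j + 1 :: complex) \<notin> \<int>\<^sub>\<le>\<^sub>0"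
    using of_nat_in_nonpos_Ints_iff[of "Suc j", where 'a = complex] by (simp add: add.commute)
  have j2: "of_nat j + 1 + 1 = (of_nat j + 2 :: complex)" by simp
  have "complex_of_real ((real j + 1) * y\<^sub>1 - (real j + 1 - A) * y\<^sub>2) = of_real (A * y\<^sub>3)"
    using Gauss_2F1_contiguous_upper_lower[OF z j1, of "of_real A" "of_real B"] unfolding j2 y1 y2 y3 by simp
  then have "(real j + 1) * y\<^sub>1 - (real j + 1 - A) * y\<^sub>2 = A * y\<^sub>3"
    unfolding of_real_eq_iff .
  moreover have "A * y\<^sub>3 \<ge> 0" using AB y3 by simp
  \<comment> \<open>Uses \<open>real j + 1 - A = - \<alpha>\<close>.\<close>
  ultimately have ge: "- \<alpha> * y\<^sub>2 \<le> (real j + 1) * y\<^sub>1" by (simp add: A_def algebra_simps)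
  \<comment> \<open>The leading terms of the regularised \<open>G\<close> and \<open>F\<close> have
    quotient \<open>(j + 1) / (\<alpha> * \<beta> * x)\<close>, and the remaining series have the
    values \<open>y\<^sub>1\<close> and \<open>y\<^sub>2\<close>; the factor \<open>- j\<close> is
    \<gamma>.\<close>
  define h where "h = - real j * (real j + 1) * y\<^sub>1 / (\<alpha> * \<beta> * x * y\<^sub>2)"
  have "x * h = (real j / (\<alpha> * \<beta> * y\<^sub>2)) * (- ((real j + 1) * y\<^sub>1))"
    using x by (simp add: h_def)
  also have "\<dots> \<le> (real j / (\<alpha> * \<beta> * y\<^sub>2)) * (\<alpha> * y\<^sub>2)"
    using ge \<alpha> \<beta> y2 by (intro mult_left_mono) (auto simp: mult_neg_neg less_imp_le)
  also have "\<dots> = real j / \<beta>"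
    using \<alpha> y2 by simp
  finally have le: "x * h \<le> real j / \<beta>" .
  define P Q where "P = pochhammer (of_real \<alpha> + 1 :: complex) j" and "Q = pochhammer (of_real \<beta> + 1 :: complex) j"
  have shift: "of_real u + of_nat (Suc j) = complex_of_real (u + real j + 1)"
     "of_real u + 1 + of_nat j = complex_of_real (u + real j + 1)" for u by simp_all
  have f: "reg_2F1 (of_real \<alpha>) (of_real \<beta>) (- of_nat j) (of_real x) =
      (of_real \<alpha> * P) * (of_real \<beta> * Q) / ((of_nat j + 1) * fact j) * (of_real x * of_real x ^ j) * of_real y\<^sub>2"
    using reg_2F1_nonpos[OF z, of "of_real \<alpha>" "of_real \<beta>" "Suc j"]
    unfolding shift A_def[symmetric] B_def[symmetric] pochhammer_rec[of "of_real u" for u] P_def Q_def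
    by (simp add: y2 add_ac)
  have g: "reg_2F1 (of_real \<alpha> + 1) (of_real \<beta> + 1) (- of_nat j + 1) (of_real x) =
      P * Q / fact j * of_real x ^ j * of_real y\<^sub>1"
    using reg_2F1_nonpos[OF z, of "of_real \<alpha> + 1" "of_real \<beta> + 1" j]
    unfolding shift A_def[symmetric] B_def[symmetric] P_def Q_def
    by (simp add: y1)
  have nj: "of_nat j + 1 \<noteq> (0 :: complex)" using j1 by auto
  show thesis
  proof (rule that[OF _ le])
    have frac: "- u * (P * Q / F * v * y1) = (- u * (u + 1) * y1 / (s * t * z * y2)) *
          ((s * P) * (t * Q) / ((u + 1) * F) * (z * v) * y2)"
      if "u + 1 \<noteq> 0" "s \<noteq> 0" "t \<noteq> 0" "z \<noteq> 0" "y2 \<noteq> 0" "F \<noteq> 0" for u v F s t z y1 y2 :: complex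
      using that by (simp add: divide_simps)
    have "of_real h = (- of_nat j * (of_nat j + 1) * of_real y\<^sub>1 /
            (of_real \<alpha> * of_real \<beta> * of_real x * of_real y\<^sub>2) :: complex)"
      by (simp add: h_def)
    then show "- of_nat j * reg_2F1 (of_real \<alpha> + 1) (of_real \<beta> + 1) (- of_nat j + 1) (of_real x) =
       of_real h * reg_2F1 (of_real \<alpha>) (of_real \<beta>) (- of_nat j) (of_real x)"
      unfolding f g using frac[OF nj, of "of_real \<alpha>" "of_real \<beta>" "of_real x" "of_real y\<^sub>2" "fact j" "of_real x ^ j" "of_real y\<^sub>1"] \<alpha> \<beta> x y2
      by simp
  qed
qed

section \<open>Rational functions at infinity and the contradiction between the two bounds\<close>

lemma poly_nonzero_at_infinity:
  fixes T :: "complex poly"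
  assumes "T \<noteq> 0"
  shows "\<forall>\<^sub>F w in at_infinity. poly T w \<noteq> 0"
proof -
  obtain K where K: "norm w \<le> K" if "poly T w = 0" for w
    using finite_imp_bounded[OF poly_roots_finite[OF assms]] unfolding bounded_iff by auto
  show ?thesis
    unfolding eventually_at_infinity by (rule exI[of _ "K + 1"]) (use K in force)
qed

text \<open>A bound on the positive ray alone excludes \<open>degree A > degree B\<close>, and then
  the limit exists in every direction. This is what transfers information from the ray to the poles
  on the opposite side.\<close>

lemma poly_quotient_tendsto:
  fixes A B :: "complex poly"
  assumes B: "B \<noteq> 0"
    and bound: "\<forall>\<^sub>F t in at_top. norm (poly A (of_real t)) \<le> K * norm (poly B (of_real t))"
  obtains L where "((\<lambda>w. poly A w / poly B w) \<longlongrightarrow> L) at_infinity"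
proof (cases "degree A \<le> degree B")
  case True
  define c where "c = coeff A (degree B) / lead_coeff B"
  define A' where "A' = A - smult c B"
  have "coeff A' (degree B) = 0"
    using B by (simp add: A'_def c_def)
  moreover have "degree A' \<le> degree B"
    unfolding A'_def using True by (intro degree_diff_le) (auto intro: order_trans[OF degree_smult_le])
  ultimately have "A' = 0 \<or> degree A' < degree B"
    by (metis leading_coeff_0_iff le_neq_implies_less)
  then have "((\<lambda>w. poly A' w / poly B w) \<longlongrightarrow> 0) at_infinity"
    using poly_divide_tendsto_0_at_infinity[of A' B] by auto
  then have "((\<lambda>w. c + poly A' w / poly B w) \<longlongrightarrow> c + 0) at_infinity"
    by (intro tendsto_intros)
  moreover have "\<forall>\<^sub>F w in at_infinity. c + poly A' w / poly B w = poly A w / poly B w"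
    using poly_nonzero_at_infinity[OF B] by eventually_elim (simp add: A'_def field_simps)
  ultimately show thesis
    using that[of "c + 0"] by (simp add: tendsto_cong)
next
  case False
  have inf: "filterlim complex_of_real at_infinity at_top"
    by (rule filterlim_of_real_at_infinity)
  have A: "A \<noteq> 0" using False by auto
  have "((\<lambda>w. poly B w / poly A w) \<longlongrightarrow> 0) at_infinity"
    using poly_divide_tendsto_0_at_infinity[of B A] False by auto
  then have "((\<lambda>t. poly B (of_real t) / poly A (of_real t)) \<longlongrightarrow> 0) at_top"
    using inf by (rule filterlim_compose)
  \<comment> \<open>The summand 1 keeps the threshold meaningful for \<open>K = 0\<close> and makes
    the resulting estimate contradict the bound by \<open>K\<close> strictly.\<close>
  then have "\<forall>\<^sub>F t in at_top. norm (poly B (of_real t) / poly A (of_real t)) < 1 / (\<bar>K\<bar> + 1)"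
    unfolding tendsto_iff dist_norm by (auto dest: spec[of _ "1 / (\<bar>K\<bar> + 1)"])
  moreover have "\<forall>\<^sub>F t in at_top. poly A (of_real t) \<noteq> 0"
    using filterlim_iff[THEN iffD1, OF inf] poly_nonzero_at_infinity[OF A] by blast
  ultimately have "\<forall>\<^sub>F t :: real in at_top. False"
    using bound
  proof eventually_elim
    case (elim t)
    define \<alpha> \<beta> where "\<alpha> = norm (poly A (of_real t))" and "\<beta> = norm (poly B (of_real t))"
    have \<alpha>: "\<alpha> > 0" "\<alpha> \<le> K * \<beta>" "\<beta> \<ge> 0" "\<beta> / \<alpha> < 1 / (\<bar>K\<bar> + 1)"
      using elim by (auto simp: \<alpha>_def \<beta>_def norm_divide)
    then have "\<beta> * (\<bar>K\<bar> + 1) < \<alpha>"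
      by (simp add: divide_simps split: if_splits)
    moreover have "K * \<beta> \<le> \<beta> * \<bar>K\<bar>"
      using mult_right_mono[OF abs_ge_self[of K] \<alpha>(3)] by (simp add: mult.commute)
    ultimately show ?case using \<alpha> by (simp add: distrib_left)
  qed
  then show thesis by (simp add: eventually_False)
qed

text \<open>The derivative of the hypergeometric function in \<open>x\<close>, divided by the
  function, is \<open>\<alpha> \<beta> / \<gamma>\<close> times \<open>G / F\<close> for the
  ordinary series; it is rational in \<open>w\<close> exactly if that quotient is. By
  \<open>key\<close> the quotient equals \<open>A / B\<close> wherever the regularised
  \<open>F\<close> and \<open>B\<close> are nonzero, including actual poles.\<close>

lemma no_rational_logarithmic_derivative:
  fixes p q r a b x :: real and A B :: "complex poly"
  assumes pqr: "0 < p" "p < r" "0 < q" "q < r" and x: "\<bar>x\<bar> < 1" "x \<noteq> 0" and B: "B \<noteq> 0"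
    and inf: "infinite {w. is_pole (hyp_f (of_real p) (of_real q) (of_real r) (of_real a) (of_real b) (of_real x)) w}"
  defines "F \<equiv> \<lambda>w. reg_2F1 (of_real p * w + of_real a) (of_real q * w + of_real b) (of_real r * w) (of_real x)"
    and "G \<equiv> \<lambda>w. reg_2F1 (of_real p * w + of_real a + 1) (of_real q * w + of_real b + 1) (of_real r * w + 1) (of_real x)"
  assumes key: "\<And>w. F w \<noteq> 0 \<Longrightarrow> poly A w * F w = poly B w * (of_real r * w * G w)"
  shows False
proof -
  have quotient: "poly A w = poly B w * of_real h"
    if "F w \<noteq> 0" "of_real r * w * G w = of_real h * F w" for w h
  proof -
    have "poly A w * F w = poly B w * of_real h * F w"
      using key[OF that(1)] that(2) by simp
    then show ?thesis using that(1) by simp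
  qed

  have right: "\<forall>\<^sub>F t :: real in at_top. \<exists>h. poly A (of_real t) = poly B (of_real t) * of_real h \<and>
      0 \<le> h \<and> h \<le> r * t / ((1 - x) * (q * t + b))"
  proof -
    have "\<forall>\<^sub>F t in at_top. 0 < p * t + a" "\<forall>\<^sub>F t in at_top. 0 < q * t + b"
        "\<forall>\<^sub>F t in at_top. q * t + b < r * t"
      using pqr by real_asymp+
    then show ?thesis
    proof eventually_elim
      case (elim t)
      obtain h where "F (of_real t) \<noteq> 0" "of_real r * of_real t * G (of_real t) = of_real h * F (of_real t)"
          "0 \<le> h" "h \<le> r * t / ((1 - x) * (q * t + b))"
        using reg_2F1_quotient_right[OF x(1) elim] unfolding F_def G_def by auto
      then show ?case using quotient by blast
    qed
  qed
  \<comment> \<open>Twice the limit of the upper bound, to have a strict inequality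
    eventually.\<close>
  define K where "K = 2 * r / ((1 - x) * q)"
  have "\<forall>\<^sub>F t :: real in at_top. norm (poly A (of_real t)) \<le> K * norm (poly B (of_real t))"
  proof -
    have "((\<lambda>t. r * t / ((1 - x) * (q * t + b))) \<longlongrightarrow> r / ((1 - x) * q)) at_top"
      using pqr x by (real_asymp; simp add: divide_inverse)
    moreover have "r / ((1 - x) * q) < K"
      using pqr x by (simp add: K_def field_simps)
    ultimately have "\<forall>\<^sub>F t in at_top. r * t / ((1 - x) * (q * t + b)) < K"
      by (rule order_tendstoD)
    with right show ?thesis
    proof eventually_elim
      case (elim t)
      then obtain h where h: "poly A (of_real t) = poly B (of_real t) * of_real h" "0 \<le> h" "h \<le> K"
        by force
      then show ?case by (simp add: norm_mult mult.commute[of K] mult_left_mono)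
    qed
  qed
  then obtain L where L: "((\<lambda>w. poly A w / poly B w) \<longlongrightarrow> L) at_infinity"
    using poly_quotient_tendsto[OF B] by blast
  \<comment> \<open>For \<open>x > 0\<close> the bound \<open>0 \<le> h\<close> is multiplied by
    \<open>x\<close>, for \<open>x < 0\<close> the upper bound for \<open>h\<close> is;
    \<open>c\<close> is the resulting factor. It exceeds -1 since
    \<open>x / (1 - x) + 1 = 1 / (1 - x)\<close>.\<close>
  define c where "c = min 0 (x / (1 - x))"
  have c: "- 1 < c" using x by (auto simp: c_def field_simps)
  have of_real_inf: "filterlim complex_of_real at_infinity at_top"
    by (rule filterlim_of_real_at_infinity)

  have "c * (r / q) \<le> x * Re L"
  proof (rule tendsto_le[OF trivial_limit_at_top_linorder])
    show "((\<lambda>t. x * Re (poly A (of_real t) / poly B (of_real t))) \<longlongrightarrow> x * Re L) at_top"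
      by (intro tendsto_intros filterlim_compose[OF L of_real_inf])
    show "((\<lambda>t. c * (r * t / (q * t + b))) \<longlongrightarrow> c * (r / q)) at_top"
    proof (rule tendsto_mult_left)
      show "((\<lambda>t. r * t / (q * t + b)) \<longlongrightarrow> r / q) at_top"
        using pqr by (real_asymp; simp add: divide_inverse)
    qed
    have "\<forall>\<^sub>F t in at_top. poly B (of_real t) \<noteq> 0"
      using filterlim_iff[THEN iffD1, OF of_real_inf] poly_nonzero_at_infinity[OF B] by blast
    moreover have "\<forall>\<^sub>F t in at_top. 0 < r * t / (q * t + b)"
      using pqr by real_asymp
    ultimately show "\<forall>\<^sub>F t in at_top. c * (r * t / (q * t + b)) \<le> x * Re (poly A (of_real t) / poly B (of_real t))"
      using right
    proof eventually_elim
      case (elim t)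
      then obtain h where h: "poly A (of_real t) = poly B (of_real t) * of_real h" "0 \<le> h"
          "h \<le> r * t / ((1 - x) * (q * t + b))" by blast
      define u where "u = r * t / (q * t + b)"
      have u: "u > 0" "h \<le> u / (1 - x)" using elim h by (auto simp: u_def mult.commute)
      have "c * u \<le> x * h"
      proof (cases "x > 0")
        case True
        then have "c = 0" using x by (simp add: c_def)
        then show ?thesis using True h by simp
      next
        case False
        then have "c = x / (1 - x)" using x by (simp add: c_def divide_nonpos_pos)
        then show ?thesis
          using mult_left_mono_neg[OF u(2), of x] False by (simp add: mult.commute)
      qed
      then show ?case using elim h by (simp add: u_def)
    qed
  qed
  moreover have "- (r / q) < c * (r / q)"
    using c pqr mult_strict_right_mono[of "-1" c "r / q"] by simp
  ultimately have pos: "x * Re L + r / q > 0" by simp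

  define w where "w j = complex_of_real (- real j / r)" for j
  \<comment> \<open>Some \<open>w j\<close> may fail to be poles because \<open>F\<close> vanishes
    there; an infinite set of indices is enough.\<close>
  define J where "J = {j. is_pole (hyp_f (of_real p) (of_real q) (of_real r) (of_real a) (of_real b) (of_real x)) (w j)}"
  have cx: "norm (complex_of_real x) < 1" "complex_of_real r \<noteq> 0" using x pqr by auto
  have "{w. is_pole (hyp_f (of_real p) (of_real q) (of_real r) (of_real a) (of_real b) (of_real x)) w} \<subseteq> w ` J"
  proof
    fix v assume v: "v \<in> {w. is_pole (hyp_f (of_real p) (of_real q) (of_real r) (of_real a) (of_real b) (of_real x)) w}"
    then have "of_real r * v \<in> \<int>\<^sub>\<le>\<^sub>0"
      using is_pole_hyp_f(1)[OF cx] by blast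
    then obtain j where "of_real r * v = - of_nat j"
      by (elim nonpos_Ints_cases')
    then have "v = w j"
      using cx(2) by (simp add: w_def field_simps)
    then show "v \<in> w ` J"
      using v by (auto simp: J_def)
  qed
  then have "infinite J"
    using inf finite_subset by blast

  have "filterlim (\<lambda>j. norm (w j)) at_top sequentially"
    unfolding w_def norm_of_real using pqr by real_asymp
  then have w_inf: "filterlim w at_infinity sequentially"
    by (simp add: filterlim_at_infinity_conv_norm_at_top)
  \<comment> \<open>The limit is the positive number \<open>x * Re L + r / q\<close>, whereas at a
    pole with large \<open>j\<close> the left quotient bound makes the expression at most 0.\<close>
  have "((\<lambda>j. x * Re (poly A (w j) / poly B (w j)) - real j / (b - q * real j / r)) \<longlongrightarrow> x * Re L - (- (r / q))) sequentially"
  proof (intro tendsto_diff tendsto_mult_left tendsto_Re filterlim_compose[OF L w_inf])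
    show "(\<lambda>j. real j / (b - q * real j / r)) \<longlonglongrightarrow> - (r / q)"
      using pqr by (real_asymp; simp add: field_simps)
  qed
  then have "\<forall>\<^sub>F j in sequentially. 0 < x * Re (poly A (w j) / poly B (w j)) - real j / (b - q * real j / r)"
    using pos by (intro order_tendstoD(1)[where a = 0]) simp_all
  moreover have "\<forall>\<^sub>F j in sequentially. poly B (w j) \<noteq> 0"
    using poly_nonzero_at_infinity[OF B] w_inf unfolding filterlim_iff by blast
  moreover have "\<forall>\<^sub>F j in sequentially. a - p * real j / r < 0" "\<forall>\<^sub>F j in sequentially. b - q * real j / r < 0"
      "\<forall>\<^sub>F j in sequentially. 0 < a - p * real j / r + real j + 1"
      "\<forall>\<^sub>F j in sequentially. 0 < b - q * real j / r + real j + 1"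
  proof -
    show "\<forall>\<^sub>F j in sequentially. a - p * real j / r < 0" "\<forall>\<^sub>F j in sequentially. b - q * real j / r < 0"
      using pqr by real_asymp+
    \<comment> \<open>The upper parameters tend to minus infinity along the poles, but more slowly
      than \<open>- j\<close>, so after the shift by \<open>j + 1\<close> they are positive.\<close>
    have "1 - p / r > 0" "1 - q / r > 0" using pqr by (auto simp: field_simps)
    then have "\<forall>\<^sub>F j in sequentially. 0 < a + (1 - p / r) * real j + 1" "\<forall>\<^sub>F j in sequentially. 0 < b + (1 - q / r) * real j + 1"
      by real_asymp+
    then show "\<forall>\<^sub>F j in sequentially. 0 < a - p * real j / r + real j + 1"
      "\<forall>\<^sub>F j in sequentially. 0 < b - q * real j / r + real j + 1"
      by (auto elim!: eventually_mono simp: algebra_simps)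
  qed
  ultimately have "\<forall>\<^sub>F j in sequentially. j \<notin> J"
  proof eventually_elim
    case (elim j)
    show ?case
    proof
      assume "j \<in> J"
      define \<alpha> \<beta> where "\<alpha> = a - p * real j / r" and "\<beta> = b - q * real j / r"
      have args: "of_real p * w j + of_real a = of_real \<alpha>" "of_real q * w j + of_real b = of_real \<beta>"
          "of_real r * w j = - of_nat j"
        using pqr by (simp_all add: \<alpha>_def \<beta>_def w_def)
      have nz: "F (w j) \<noteq> 0"
        using \<open>j \<in> J\<close> is_pole_hyp_f(2)[OF cx] unfolding J_def F_def by blast
      obtain h where h: "of_real r * w j * G (w j) = of_real h * F (w j)" "x * h \<le> real j / \<beta>"
        using reg_2F1_quotient_left[OF x, of \<alpha> j \<beta>] elim unfolding F_def G_def args \<alpha>_def[symmetric] \<beta>_def[symmetric]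
        by blast
      have "poly A (w j) / poly B (w j) = of_real h"
        using quotient[OF nz h(1)] elim by simp
      then show False using elim h(2) by (simp add: \<beta>_def)
    qed
  qed
  then show False
    using \<open>infinite J\<close> by (simp add: infinite_nat_iff_unbounded_le eventually_sequentially) blast
qed

section \<open>Polynomials in four variables restricted to the line\<close>

lemma poly_along_line:
  fixes P :: "complex poly"
  shows "\<exists>T. \<forall>w. poly P (p * w + a) = poly T w"
  by (rule exI[of _ "pcompose P [:a, p:]"]) (simp add: poly_pcompose algebra_simps)

lemma poly2_along_line:
  fixes P :: "complex poly poly"
  shows "\<exists>T. \<forall>w. poly (poly P [:q * w + b:]) (p * w + a) = poly T w"
proof (induction P)
  case 0 then show ?case by (intro exI[of _ 0]) simp
next
  case (pCons c P)
  obtain S T where "\<forall>w. poly c (p * w + a) = poly S w"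
      "\<forall>w. poly (poly P [:q * w + b:]) (p * w + a) = poly T w"
    using poly_along_line[of c p a] pCons.IH by blast
  then show ?case
    by (intro exI[of _ "S + [:b, q:] * T"]) (simp add: algebra_simps)
qed

lemma poly3_along_line:
  fixes P :: "complex poly poly poly"
  shows "\<exists>T. \<forall>w. poly (poly (poly P [:[:r * w:]:]) [:q * w + b:]) (p * w + a) = poly T w"
proof (induction P)
  case 0 then show ?case by (intro exI[of _ 0]) simp
next
  case (pCons c P)
  obtain S T where "\<forall>w. poly (poly c [:q * w + b:]) (p * w + a) = poly S w"
      "\<forall>w. poly (poly (poly P [:[:r * w:]:]) [:q * w + b:]) (p * w + a) = poly T w"
    using poly2_along_line[of c q b p a] pCons.IH by blast
  then show ?case
    by (intro exI[of _ "S + [:0, r:] * T"]) (simp add: algebra_simps)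
qed

text \<open>Turns identical vanishing of \<open>Q(w)\<close> into the vanishing of one polynomial in
  \<open>w\<close>.\<close>

lemma eval4_along_line: "\<exists>T. \<forall>w. eval4 P (p * w + a) (q * w + b) (r * w) x = poly T w"
  using poly3_along_line[of "poly P [:[:[:x:]:]:]" r q b p a] by (simp add: eval4_def)

theorem theorem2p7:
  fixes p q r a b x :: real
  assumes "0 < p" and "p < r" and "0 < q" and "q < r"
    and "- 1 < x" and "x < 1" and "x \<noteq> 0"
    and "type_A (of_real p) (of_real q) (of_real r) (of_real a) (of_real b) (of_real x)"
  shows "from_contiguous_relations
           (of_real p) (of_real q) (of_real r) (of_real a) (of_real b) (of_real x)"
proof -
  define p' q' r' a' b' x' where "p' = complex_of_real p" and "q' = complex_of_real q"
    and "r' = complex_of_real r" and "a' = complex_of_real a" and "b' = complex_of_real b"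
    and "x' = complex_of_real x"
  note defs = p'_def q'_def r'_def a'_def b'_def x'_def
  note defs_sym = defs[symmetric]
  have nz: "p' \<noteq> 0" "q' \<noteq> 0" "r' \<noteq> 0" "r' \<noteq> p'" "r' \<noteq> q'" "x' \<noteq> 0" "x' \<noteq> 1" and x': "norm x' < 1"
    using assms unfolding defs by auto
  obtain k l m :: int where klm: "p' = of_int k" "q' = of_int l" "r' = of_int m"
    using assms(8) unfolding type_A_def defs by blast
  \<comment> \<open>Type (A) provides integers on the complex side; back on the real side they are
    positive, so the relations for natural shifts suffice.\<close>
  have "complex_of_real p = of_real (of_int k)" "complex_of_real q = of_real (of_int l)"
      "complex_of_real r = of_real (of_int m)"
    using klm unfolding defs by simp_all
  then have "p = of_int k" "q = of_int l" "r = of_int m"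
    unfolding of_real_eq_iff .
  then have "0 \<le> k" "0 \<le> l" "0 \<le> m" using assms by simp_all
  then obtain i j n where ijn: "k = int i" "l = int j" "m = int n"
    by (metis nonneg_int_cases)
  have shift: "p' = of_nat i" "q' = of_nat j" "r' = of_nat n"
    using klm ijn by simp_all
  have sol: "closed_form_solution p' q' r' a' b' x'"
    and poles: "infinite {w. is_pole (hyp_f p' q' r' a' b' x') w}"
    using assms(8) unfolding type_A_def non_elementary_def defs by auto
  obtain N\<^sub>R N\<^sub>Q D where D: "three_term_relation (int i) (int j) (int n) N\<^sub>R D N\<^sub>Q D"
    "\<forall>\<^sub>\<approx>w. eval4 D (p' * w + a') (q' * w + b') (r' * w) x' \<noteq> 0"
    and rel: "\<forall>\<alpha> \<beta> \<gamma> z. norm z < 1 \<longrightarrow> \<gamma> \<notin> \<int>\<^sub>\<le>\<^sub>0 \<longrightarrow>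
        eval4 D \<alpha> \<beta> \<gamma> z * Gauss_2F1 (\<alpha> + of_nat i) (\<beta> + of_nat j) (\<gamma> + of_nat n) z =
          eval4 N\<^sub>R \<alpha> \<beta> \<gamma> z * Gauss_2F1 \<alpha> \<beta> \<gamma> z +
          eval4 N\<^sub>Q \<alpha> \<beta> \<gamma> z * Gauss_2F1 (\<alpha> + 1) (\<beta> + 1) (\<gamma> + 1) z"
    using three_term_relation_exists[OF nz, where a = a' and b = b' and i = i and j = j and k = n]
    by (elim exE conjE)
  define line where "line P w = eval4 P (p' * w + a') (q' * w + b') (r' * w) x'" for P w
  have "\<exists>T. \<forall>w. line P w = poly T w" for P
    unfolding line_def by (rule eval4_along_line)
  then obtain T where T: "\<And>P w. line P w = poly (T P) w"
    by metis
  define T\<^sub>D T\<^sub>R T\<^sub>Q where "T\<^sub>D = T D" and "T\<^sub>R = T N\<^sub>R" and "T\<^sub>Q = T N\<^sub>Q"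
  note T_defs = T\<^sub>D_def T\<^sub>R_def T\<^sub>Q_def
  have "T\<^sub>Q = 0"
  proof (rule ccontr)
    assume "T\<^sub>Q \<noteq> 0"
    obtain P Q where Q: "Q \<noteq> 0" "\<forall>\<^sub>\<approx>w. hyp_ratio p' q' r' a' b' x' w = poly P w / poly Q w"
      using sol unfolding closed_form_solution_def rational_fun_def by blast
    \<comment> \<open>Eliminating the shifted value \<open>f'\<close> from
      \<open>T\<^sub>D f' = T\<^sub>R f + T\<^sub>Q g\<close> and \<open>Q f' = P f\<close> leaves
      \<open>A f = B g\<close>.\<close>
    define A B where "A = T\<^sub>D * P - T\<^sub>R * Q" and "B = T\<^sub>Q * Q"
    have "B \<noteq> 0" using \<open>T\<^sub>Q \<noteq> 0\<close> Q(1) by (simp add: B_def)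
    define F where "F = (\<lambda>w. reg_2F1 (p' * w + a') (q' * w + b') (r' * w) x')"
    define G where "G = (\<lambda>w. reg_2F1 (p' * w + a' + 1) (q' * w + b' + 1) (r' * w + 1) x')"
    have cont: "isCont F w" "isCont G w" for w
      using holomorphic_on_imp_continuous_on[OF reg_2F1_line_holomorphic[OF x', of p' a' q' b' r' 0]]
        holomorphic_on_imp_continuous_on[OF reg_2F1_line_holomorphic[OF x', of p' "a' + 1" q' "b' + 1" r' 1]]
      by (simp_all add: F_def G_def continuous_on_eq_continuous_at add.assoc)
    have key: "poly A w\<^sub>0 * F w\<^sub>0 = poly B w\<^sub>0 * (r' * w\<^sub>0 * G w\<^sub>0)" if "F w\<^sub>0 \<noteq> 0" for w\<^sub>0
    proof -
      \<comment> \<open>The identity is verified in a punctured neighbourhood, where the ordinary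
        series are available, and reaches \<open>w\<^sub>0\<close> itself by continuity. This covers
        the poles of \<open>f\<close>.\<close>
      define H where "H w = poly A w * F w - poly B w * (r' * w * G w)" for w
      have "\<forall>\<^sub>F w in at w\<^sub>0. F w \<noteq> 0"
        using cont(1)[of w\<^sub>0] that unfolding isCont_def by (rule tendsto_imp_eventually_ne)
      moreover have "\<forall>\<^sub>F w in at w\<^sub>0. r' * w \<notin> \<int>\<^sub>\<le>\<^sub>0"
        "\<forall>\<^sub>F w in at w\<^sub>0. hyp_ratio p' q' r' a' b' x' w = poly P w / poly Q w"
        "\<forall>\<^sub>F w in at w\<^sub>0. poly Q w \<noteq> 0"
        using cosparse_not_nonpos_Int[OF nz(3)] Q(2) poly_cosparse_nonzero[OF Q(1)]
        by (simp_all add: eventually_cosparse_open_eq)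
      ultimately have "\<forall>\<^sub>F w in at w\<^sub>0. H w = 0"
      proof eventually_elim
        case (elim w)
        have "r' * w + 1 \<notin> \<int>\<^sub>\<le>\<^sub>0"
          using not_nonpos_Int_add_of_nat[OF elim(2), of 1] by simp
        define f f' g where "f = Gauss_2F1 (p' * w + a') (q' * w + b') (r' * w) x'"
          and "f' = hyp_f p' q' r' a' b' x' (w + 1)"
          and "g = Gauss_2F1 (p' * w + a' + 1) (q' * w + b' + 1) (r' * w + 1) x'"
        have F: "F w = rGamma (r' * w) * f" and G: "G w = rGamma (r' * w + 1) * g"
          unfolding F_def G_def f_def g_def
          by (rule reg_2F1_eq[OF x' elim(2)], rule reg_2F1_eq[OF x' \<open>r' * w + 1 \<notin> \<int>\<^sub>\<le>\<^sub>0\<close>])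
        \<comment> \<open>Without this, the quotient \<open>f' / f\<close> could be 0 by convention
          and would say nothing about \<open>f'\<close>.\<close>
        have "f \<noteq> 0" using elim(1) F by auto
        moreover have "f' / f = poly P w / poly Q w"
          using elim(3) unfolding hyp_ratio_def f'_def f_def hyp_f_def .
        ultimately have ratio: "poly Q w * f' = poly P w * f"
          using elim(4) by (simp add: field_simps)
        have "f' = Gauss_2F1 (p' * w + a' + of_nat i) (q' * w + b' + of_nat j) (r' * w + of_nat n) x'"
          unfolding f'_def hyp_f_def by (simp add: shift distrib_left add_ac)
        then have "poly T\<^sub>D w * f' = poly T\<^sub>R w * f + poly T\<^sub>Q w * g"
          using rel[rule_format, OF x' elim(2), of "p' * w + a'" "q' * w + b'"]
          unfolding line_def[symmetric] T f_def g_def T_defs by simp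
        then have "poly A w * f = poly B w * g"
          using ratio unfolding A_def B_def by (simp only: poly_diff poly_mult) algebra
        \<comment> \<open>The factor \<open>r' * w\<close> converts the regularising factor of
          \<open>G\<close> into that of \<open>F\<close>.\<close>
        moreover have "r' * w * rGamma (r' * w + 1) = rGamma (r' * w)"
          by (rule rGamma_plus1)
        ultimately show ?case
          unfolding H_def F G by algebra
      qed
      then have "(H \<longlongrightarrow> 0) (at w\<^sub>0)"
        by (rule tendsto_eventually)
      moreover have "isCont H w\<^sub>0"
        unfolding H_def using cont[of w\<^sub>0] by (intro continuous_intros) auto
      ultimately have "H w\<^sub>0 = 0"
        unfolding isCont_def using tendsto_unique trivial_limit_at by blast
      then show ?thesis by (simp add: H_def)
    qed
    have "\<bar>x\<bar> < 1" using assms by auto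
    from no_rational_logarithmic_derivative[OF assms(1-4) this assms(7) \<open>B \<noteq> 0\<close> poles[unfolded defs], of A]
    show False
      using key unfolding F_def G_def defs by blast
  qed
  then have "\<forall>\<^sub>\<approx>w. eval4 N\<^sub>Q (p' * w + a') (q' * w + b') (r' * w) x' /
      eval4 D (p' * w + a') (q' * w + b') (r' * w) x' = 0"
    using T[of N\<^sub>Q] by (simp add: line_def T_defs)
  with sol D klm show ?thesis
    unfolding from_contiguous_relations_def defs_sym ijn by (intro conjI exI)
qed

end
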